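(* Let $T$ be a tessellation of $\mathbb{R}^n$ by shifts of one polyhedral cell $c$. If two facets $f_1$ and $f_2$ of $c$ meet with an obtuse angle and if $c'$, the reflection of $c$ across (the hyperplane through) $f_2$, is a cell of $T$, then $\chi(T)$ is not refinable.
   Context: A tessellation $T$ of $\mathbb{R}^n$ by shifts of one polyhedral cell $c$ is a partition of $\mathbb{R}^n$ into translates of $c$, called cells, which are unpartitioned $n$-dimensional units, cover $\mathbb{R}^n$ and have no $n$-dimensional overlap (cells may be taken half-open so that they do not overlap on facets; equalities of functions below are meant up to values on cell boundaries). Each cell is bounded by a finite number of $(n-1)$-dimensional facets. Two abutting facets $f_1,f_2$ of a cell meet with an obtuse angle if for $i=1,2$ there exist unit vectors $\mathbf{n}_i$ orthogonal to $f_i$ and pointing outward from the cell such that $\mathbf{n}_1\cdot\mathbf{n}_2>0$. The indicator function of a cell is $1$ on the cell and $0$ elsewhere; $\chi(T)$ denotes the collection of indicator functions of the cells of $T$. A scaled-down copy of $T$ is a tessellation $T^1=\lambda T+v$ with $0<\lambda<1$, $v\in\mathbb{R}^n$ (for example $\tfrac12 T$). $\chi(T)$ is refinable if, for some scaled-down copy $T^1$ of $T$, each indicator function in $\chi(T)$ is a linear combination of functions in $\chi(T^1)$. Linear combinations may involve infinitely many cells; the sums are locally finite. *)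

theory Defs
  imports "HOL-Analysis.Analysis"
begin

text \<open>Cells are represented by closed sets and need not be convex. A cell is the closure of its
  (connected) interior and a finite union of convex polytopes, so it is bounded by finitely many
  flat facets.\<close>

definition polyhedral_cell :: "'a::euclidean_space set \<Rightarrow> bool" where
  "polyhedral_cell c \<longleftrightarrow>
     (\<exists>P. finite P \<and> (\<forall>p\<in>P. polytope p) \<and> c = \<Union>P) \<and>
     interior c \<noteq> {} \<and> connected (interior c) \<and> c = closure (interior c)"

definition tessellation_by_shifts :: "'a::euclidean_space set set \<Rightarrow> 'a set \<Rightarrow> bool" where
  "tessellation_by_shifts T c \<longleftrightarrow>
     polyhedral_cell c \<and> c \<in> T \<and>
     (\<forall>d\<in>T. \<exists>v. d = (\<lambda>x. x + v) ` c) \<and>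
     \<Union>T = UNIV \<and>
     pairwise (\<lambda>d e. interior d \<inter> interior e = {}) T"

text \<open>\<open>flat_at c x u\<close>: near \<open>x\<close> the set \<open>c\<close> is a closed half-space with \<open>x\<close> on its boundary and
  outward unit normal \<open>u\<close>. The facets are the closures of the maximal connected pieces of the flat
  part of the boundary; coplanar pieces that are not connected through flat points are different
  facets.\<close>

definition flat_at :: "'a::euclidean_space set \<Rightarrow> 'a \<Rightarrow> 'a \<Rightarrow> bool" where
  "flat_at c x u \<longleftrightarrow>
     norm u = 1 \<and> (\<exists>r>0. c \<inter> ball x r = {y \<in> ball x r. u \<bullet> (y - x) \<le> 0})"

definition cell_facet :: "'a::euclidean_space set \<Rightarrow> 'a set \<Rightarrow> bool" where
  "cell_facet c f \<longleftrightarrow> (\<exists>K \<in> components {x. \<exists>u. flat_at c x u}. f = closure K)"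

definition outward_unit_normal :: "'a::euclidean_space set \<Rightarrow> 'a set \<Rightarrow> 'a \<Rightarrow> bool" where
  "outward_unit_normal c f u \<longleftrightarrow>
     norm u = 1 \<and> (\<forall>x\<in>f. \<forall>y\<in>f. u \<bullet> (x - y) = 0) \<and> (\<exists>x\<in>f. flat_at c x u)"

text \<open>Abutting facets share an \<open>(n - 2)\<close>-dimensional piece. The convex witness \<open>S\<close> is needed because
  the intersection of two facets of a non-convex cell need not be convex, so that its own
  \<open>aff_dim\<close> may exceed its dimension.\<close>

definition abutting :: "'a::euclidean_space set \<Rightarrow> 'a set \<Rightarrow> bool" where
  "abutting f1 f2 \<longleftrightarrow>
     (\<exists>S. S \<noteq> {} \<and> S \<subseteq> f1 \<inter> f2 \<and> convex S \<and> aff_dim S = int DIM('a) - 2)"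

definition meet_with_obtuse_angle ::
    "'a::euclidean_space set \<Rightarrow> 'a set \<Rightarrow> 'a set \<Rightarrow> bool" where
  "meet_with_obtuse_angle c f1 f2 \<longleftrightarrow>
     abutting f1 f2 \<and>
     (\<exists>n1 n2. outward_unit_normal c f1 n1 \<and> outward_unit_normal c f2 n2 \<and> n1 \<bullet> n2 > 0)"

text \<open>Reflection across an affine subspace; \<open>closest_point A\<close> is the orthogonal projection onto it.\<close>

definition reflection_across :: "'a::euclidean_space set \<Rightarrow> 'a \<Rightarrow> 'a" where
  "reflection_across A x = 2 *\<^sub>R closest_point A x - x"

definition chi :: "'a set set \<Rightarrow> ('a \<Rightarrow> real) set" where
  "chi T = indicat_real ` T"

definition scaled_copy :: "real \<Rightarrow> 'a::real_vector \<Rightarrow> 'a set set \<Rightarrow> 'a set set" where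
  "scaled_copy s v T = (\<lambda>d. (\<lambda>x. s *\<^sub>R x + v) ` d) ` T"

text \<open>Linear combinations may involve infinitely many functions of \<open>chi T1\<close>; at every point \<open>x\<close>
  only finitely many of these are non-zero, because the cells are bounded translates of one another
  with non-empty disjoint interiors. Equality is required off the cell boundaries only.\<close>

definition refinable :: "'a::euclidean_space set set \<Rightarrow> bool" where
  "refinable T \<longleftrightarrow>
     (\<exists>s v. 0 < s \<and> s < 1 \<and>
        (let T1 = scaled_copy s v T in
           \<forall>f \<in> chi T. \<exists>a. \<forall>x. x \<notin> \<Union>(frontier ` (T \<union> T1)) \<longrightarrow>
             f x = (\<Sum>g | g \<in> chi T1 \<and> g x \<noteq> 0. a g * g x)))"

end

(* Let n be the outward normal of f2 and H the hyperplane through f2. The reflection across H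
fixes H, maps c to a shift of c and has no interior point in common with c; as the interior of c is
connected, c lies below H, the reflection is c + tau n with tau > 0, and every point y of c on H
yields the point y - tau n of c.

Refinability makes c a finite union of arbitrarily small homothetic copies with disjoint interiors.
At a generic point p of the common piece of f1 and f2, c coincides with p + K for a closed cone K
that is invariant under the directions of this piece, so K is a plane cone times a linear space of
codimension two. A small copy of c that contains p touches H there, hence contains a point p - s n with s > 0; since its
interior is connected, it lies in a single sector of K, and therefore every sector of K has -n in its
closure. With the obtuse angle this puts -n in the interior of K, unless p is a flat point, in which
case f1 = f2.

Conversely, take a small copy of c that touches a flat piece of f2, and let q be its image of p. If K
is not the whole lower half-space, some much smaller copy contains q and lies in c outside the first
copy. It contains q - s n for some s > 0, so -n is not in the interior of K. Hence K is a half-space,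
p is flat, and f1 = f2, a contradiction. *)

theory Submission
  imports Defs
begin

section \<open>Homothetic subdivisions\<close>

text \<open>The cells of \<open>T\<close> have this form with ratio 1 and those of a scaled copy
  with ratio \<open>s\<close>, so one calculus serves all scales.\<close>

definition homothet :: "real \<Rightarrow> 'a::real_vector \<Rightarrow> 'a set \<Rightarrow> 'a set" where
  "homothet t u c = (\<lambda>x. t *\<^sub>R x + u) ` c"

lemma homothetI: "x \<in> c \<Longrightarrow> t *\<^sub>R x + u \<in> homothet t u c"
  unfolding homothet_def by (rule imageI)

lemma homothet_homothet: "homothet s u (homothet t v c) = homothet (s * t) (s *\<^sub>R v + u) c"
  by (simp add: homothet_def image_image scaleR_add_right add.assoc)

lemma homothet_mono: "c \<subseteq> d \<Longrightarrow> homothet t u c \<subseteq> homothet t u d"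
  by (auto simp: homothet_def)

lemma homothet_UN: "homothet t u (\<Union>i\<in>I. f i) = (\<Union>i\<in>I. homothet t u (f i))"
  by (auto simp: homothet_def)

lemma interior_homothet:
  fixes c :: "'a::euclidean_space set"
  assumes "t \<noteq> 0"
  shows "interior (homothet t u c) = homothet t u (interior c)"
proof -
  have *: "homothet t u d = (+) u ` (*\<^sub>R) t ` d" for d :: "'a set"
    by (auto simp: homothet_def image_image add.commute)
  have "interior ((*\<^sub>R) t ` c) = (*\<^sub>R) t ` interior c"
    by (rule interior_injective_linear_image) (use assms in \<open>auto simp: inj_def linear_iff scaleR_add_right\<close>)
  then show ?thesis
    unfolding * by (simp add: interior_translation)
qed

lemma closure_homothet:
  fixes c :: "'a::euclidean_space set"
  shows "closure (homothet t u c) = homothet t u (closure c)"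
proof -
  have *: "homothet t u d = (+) u ` (*\<^sub>R) t ` d" for d :: "'a set"
    by (auto simp: homothet_def image_image add.commute)
  show ?thesis
    unfolding * by (simp add: closure_translation closure_scaleR)
qed

text \<open>The pieces are recorded by their translation vectors, so that composing two subdivisions
  becomes arithmetic on vectors.\<close>

definition subdivision :: "'a::euclidean_space set \<Rightarrow> real \<Rightarrow> 'a set \<Rightarrow> bool" where
  "subdivision c t U \<longleftrightarrow> finite U \<and> c = (\<Union>u\<in>U. homothet t u c) \<and>
     pairwise (\<lambda>u v. interior (homothet t u c) \<inter> interior (homothet t v c) = {}) U"

lemma subdivision_subset: "subdivision c t U \<Longrightarrow> u \<in> U \<Longrightarrow> homothet t u c \<subseteq> c"
  unfolding subdivision_def by blast

text \<open>Each piece of ratio \<open>s\<close> is divided by the image of the subdivision of ratio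
  \<open>t\<close>. Two resulting pieces have disjoint interiors by \<open>V\<close> if they lie in
  the same piece of \<open>U\<close>, and by \<open>U\<close> otherwise.\<close>

lemma subdivision_mult:
  assumes U: "subdivision c s U" and V: "subdivision c t V" and "s \<noteq> 0" "t \<noteq> 0"
  shows "\<exists>W. subdivision c (s * t) W"
proof
  define W where "W = (\<lambda>(u, v). s *\<^sub>R v + u) ` (U \<times> V)"
  have fin: "finite U" "finite V" 
    and c: "c = (\<Union>u\<in>U. homothet s u c)" "c = (\<Union>u\<in>V. homothet t u c)"
    using U V by (auto simp: subdivision_def)
  have sub: "homothet s u (homothet t v c) = homothet (s * t) (s *\<^sub>R v + u) c" for u v
    by (rule homothet_homothet)
  have "(\<Union>w\<in>W. homothet (s * t) w c) = (\<Union>u\<in>U. \<Union>v\<in>V. homothet s u (homothet t v c))"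
    by (auto simp: W_def sub)
  also have "\<dots> = (\<Union>u\<in>U. homothet s u c)"
    by (simp add: homothet_UN[symmetric] c(2)[symmetric])
  also have "\<dots> = c"
    by (rule c(1)[symmetric])
  finally have cover: "c = (\<Union>w\<in>W. homothet (s * t) w c)" ..
  have "interior (homothet (s * t) (s *\<^sub>R v + u) c) \<inter> interior (homothet (s * t) (s *\<^sub>R v' + u') c) = {}"
    if "u \<in> U" "v \<in> V" "u' \<in> U" "v' \<in> V" "(u, v) \<noteq> (u', v')" for u u' v v'
  proof (cases "u = u'")
    case True
    then have "interior (homothet t v c) \<inter> interior (homothet t v' c) = {}"
      using V that by (auto simp: subdivision_def pairwise_def)
    moreover have "inj (\<lambda>x. s *\<^sub>R x + u)"
      using \<open>s \<noteq> 0\<close> by (auto simp: inj_def)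
    ultimately show ?thesis
      unfolding sub[symmetric] interior_homothet[OF \<open>s \<noteq> 0\<close>] \<open>u = u'\<close>
      by (simp add: homothet_def image_Int[symmetric] True)
  next
    case False
    have "interior (homothet s w (homothet t v c)) \<subseteq> interior (homothet s w c)" if "v \<in> V" for v w
      using subdivision_subset[OF V that] by (intro interior_mono homothet_mono)
    moreover have "interior (homothet s u c) \<inter> interior (homothet s u' c) = {}"
      using U that False by (auto simp: subdivision_def pairwise_def)
    ultimately show ?thesis
      unfolding sub[symmetric] using that by blast
  qed
  then have "pairwise (\<lambda>u v. interior (homothet (s * t) u c) \<inter> interior (homothet (s * t) v c) = {}) W"
    by (fastforce simp: W_def pairwise_def)
  with cover fin show "subdivision c (s * t) W"
    by (auto simp: subdivision_def W_def)
qed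

lemma subdivision_power:
  assumes "subdivision c s U" and "s \<noteq> 0"
  shows "\<exists>W. subdivision c (s ^ Suc k) W"
proof (induction k)
  case 0
  then show ?case using assms by auto
next
  case (Suc k)
  then show ?case
    using subdivision_mult[OF assms(1) _ assms(2), of "s ^ Suc k"] assms(2) by auto
qed

lemma subdivision_small:
  assumes "subdivision c s U" and "0 < s" "s < 1" and "0 < \<delta>"
  obtains t W where "0 < t" "t < \<delta>" "subdivision c t W"
proof -
  obtain k where "s ^ k < \<delta>"
    using real_arch_pow_inv[OF \<open>0 < \<delta>\<close> \<open>s < 1\<close>] by blast
  then have "s ^ Suc k < \<delta>"
    using assms(2,3) by (smt (verit) mult_left_le_one_le power_Suc zero_less_power)
  moreover obtain W where "subdivision c (s ^ Suc k) W"
    using subdivision_power[OF assms(1)] assms(2) by (metis less_irrefl)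
  ultimately show thesis
    using that assms(2) by (metis zero_less_power)
qed

section \<open>From refinability to a finite subdivision of the cell\<close>

lemma finite_homothets_inside:
  fixes c :: "'a::euclidean_space set"
  assumes "bounded c" "interior c \<noteq> {}" "t \<noteq> 0"
    and disj: "pairwise (\<lambda>u v. interior (homothet t u c) \<inter> interior (homothet t v c) = {}) U"
    and sub: "\<And>u. u \<in> U \<Longrightarrow> homothet t u c \<subseteq> c"
  shows "finite U"
proof (rule ccontr)
  assume inf: "infinite U"
  obtain x r where r: "0 < r" "ball x r \<subseteq> interior c"
    using assms(2) by (metis all_not_in_conv open_contains_ball open_interior)
  have xc: "x \<in> c"
    using r interior_subset by (metis centre_in_ball subset_iff)
  obtain B where B: "\<And>y. y \<in> c \<Longrightarrow> norm y \<le> B"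
    using assms(1) by (auto simp: bounded_iff)
  have "norm u \<le> B + norm (t *\<^sub>R x)" if "u \<in> U" for u
  proof -
    have "t *\<^sub>R x + u \<in> c"
      using sub[OF that] homothetI[OF xc] by blast
    then have "norm (t *\<^sub>R x + u) \<le> B" by (rule B)
    then show ?thesis
      using norm_triangle_ineq4[of "t *\<^sub>R x + u" "t *\<^sub>R x"] by simp
  qed
  then have "bounded U"
    by (auto simp: bounded_iff)
  define d where "d = \<bar>t\<bar> * r"
  have "d > 0" using r assms(3) by (simp add: d_def)
  \<comment> \<open>A packing argument: each copy contains a ball of radius \<open>d\<close>, so two
    closer copies would share an interior point. A bounded set of vectors with such gaps is
    finite.\<close>
  have "dist u v \<ge> d" if "u \<in> U" "v \<in> U" "u \<noteq> v" for u v
  proof (rule ccontr)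
    assume "\<not> d \<le> dist u v"
    then have lt: "norm (u - v) < \<bar>t\<bar> * r"
      by (simp add: d_def dist_norm)
    \<comment> \<open>The copy at \<open>v\<close> maps \<open>y\<close> to the centre of the ball
      in the copy at \<open>u\<close>.\<close>
    define y where "y = x + (1 / t) *\<^sub>R (u - v)"
    have "dist x y = norm (u - v) / \<bar>t\<bar>"
      by (simp add: y_def dist_norm divide_inverse)
    then have "dist x y < r"
      using lt assms(3) by (simp add: pos_divide_less_eq mult.commute)
    then have "t *\<^sub>R y + v \<in> interior (homothet t v c)"
      unfolding interior_homothet[OF assms(3)] using r by (intro homothetI) auto
    moreover have "t *\<^sub>R y + v = t *\<^sub>R x + u"
      using assms(3) by (simp add: y_def scaleR_add_right)
    moreover have "t *\<^sub>R x + u \<in> interior (homothet t u c)"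
      unfolding interior_homothet[OF assms(3)] using r by (intro homothetI) auto
    ultimately show False
      using disj that unfolding pairwise_def by (metis IntI empty_iff)
  qed
  then have "uniform_discrete U"
    unfolding uniform_discrete_def using \<open>d > 0\<close> by (metis not_le)
  with inf show False
    using \<open>bounded U\<close> uniform_discrete_finite_iff by blast
qed

text \<open>Frontiers of closed sets are nowhere dense. Refinability gives equations only off the
  frontiers of all cells; density of the remaining points lets every non-empty open set be
  tested.\<close>

lemma Baire_dense:
  fixes \<F> :: "'a::euclidean_space set set"
  assumes "countable \<F>" and closed: "\<And>d. d \<in> \<F> \<Longrightarrow> closed d"
  shows "closure (- \<Union>(frontier ` \<F>)) = UNIV"
proof -
  have "UNIV \<subseteq> closure (\<Inter>((\<lambda>d. - frontier d) ` \<F>))"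
  proof (rule Baire)
    fix S assume "S \<in> (\<lambda>d. - frontier d) ` \<F>"
    then obtain d where d: "d \<in> \<F>" "S = - frontier d" by blast
    have "closure S = UNIV"
      using closed[OF d(1)]
      by (auto simp: d(2) closure_complement frontier_def interior_diff dest: subsetD[OF closure_subset])
    then show "openin (top_of_set UNIV) S \<and> UNIV \<subseteq> closure S"
      by (simp add: d(2) open_Compl)
  qed (use assms in auto)
  moreover have "\<Inter>((\<lambda>d. - frontier d) ` \<F>) = - \<Union>(frontier ` \<F>)"
    by blast
  ultimately show ?thesis
    by (metis top.extremum_uniqueI)
qed

text \<open>Off the frontiers a point lies in exactly one fine cell, so the indicator function of
  \<open>c\<close> is constant on the interior of each fine cell. A fine cell that meets the
  interior of \<open>c\<close> is therefore contained in \<open>c\<close>, and these fine cells fill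
  \<open>c\<close>.\<close>

lemma refinable_subdivision:
  fixes c :: "'a::euclidean_space set"
  assumes tess: "tessellation_by_shifts T c" and "refinable T"
  obtains s U where "0 < s" "s < 1" "subdivision c s U"
proof -
  obtain s v where s: "0 < s" "s < 1"
    and ref: "\<And>f. f \<in> chi T \<Longrightarrow> \<exists>a. \<forall>x. x \<notin> \<Union>(frontier ` (T \<union> scaled_copy s v T)) \<longrightarrow>
       f x = (\<Sum>g | g \<in> chi (scaled_copy s v T) \<and> g x \<noteq> 0. a g * g x)"
    using \<open>refinable T\<close> unfolding refinable_def Let_def by blast
  define T1 where "T1 = scaled_copy s v T"
  define N where "N = \<Union>(frontier ` (T \<union> T1))"
  have cell: "polyhedral_cell c" and "c \<in> T" "\<Union>T = UNIV"
    and shift: "\<And>d. d \<in> T \<Longrightarrow> \<exists>w. d = homothet 1 w c"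
    and disjT: "pairwise (\<lambda>d e. interior d \<inter> interior e = {}) T"
    using tess by (auto simp: tessellation_by_shifts_def homothet_def)
  have ne: "interior c \<noteq> {}" and cl: "c = closure (interior c)"
    using cell by (auto simp: polyhedral_cell_def)
  have "bounded c"
    using cell by (auto simp: polyhedral_cell_def polytope_imp_bounded)
  have T1_eq: "T1 = homothet s v ` T"
    by (simp add: T1_def scaled_copy_def homothet_def[abs_def])
  have T1_cell: "\<exists>u. d = homothet s u c" if "d \<in> T1" for d
  proof -
    obtain e w where "e \<in> T" "d = homothet s v e" "e = homothet 1 w c"
      using \<open>d \<in> T1\<close> shift unfolding T1_eq by blast
    then have "d = homothet (s * 1) (s *\<^sub>R w + v) c"
      by (simp only: homothet_homothet)
    then show ?thesis by auto
  qed
  have closed: "closed d" if "d \<in> T \<union> T1" for d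
  proof -
    have "closed (homothet t w c)" for t w
      by (subst cl) (simp add: closure_homothet[symmetric])
    then show ?thesis using that shift T1_cell by blast
  qed
  have nonempty: "interior d \<noteq> {}" if "d \<in> T" for d
  proof -
    obtain w where "d = homothet 1 w c" using shift \<open>d \<in> T\<close> by blast
    then have "interior d = homothet 1 w (interior c)"
      by (simp add: interior_homothet)
    then show ?thesis using ne by (simp add: homothet_def)
  qed
  \<comment> \<open>Disjoint non-empty open sets are countably many, which makes \<open>T\<close>
    countable as the Baire argument requires.\<close>
  have "disjoint (interior ` T)"
    using disjT by (intro pairwise_imageI) (simp add: pairwise_def disjnt_def)
  then have "countable (interior ` T)"
    by (rule countable_disjoint_open_subsets[rotated]) auto
  moreover have "inj_on interior T"
  proof (rule inj_onI, rule ccontr)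
    fix d e assume "d \<in> T" "e \<in> T" "interior d = interior e" "d \<noteq> e"
    then show False
      using pairwiseD[OF disjT \<open>d \<in> T\<close> \<open>e \<in> T\<close>] nonempty[of d] by simp
  qed
  ultimately have "countable T"
    by (rule countable_image_inj_on)
  then have "closure (- N) = UNIV"
    unfolding N_def by (intro Baire_dense) (auto simp: T1_eq intro: closed)
  then have dense: "\<exists>x\<in>A. x \<notin> N" if "open A" "A \<noteq> {}" for A
    using that open_Int_closure_eq_empty[OF that(1), of "- N"] by auto
  have disjT1: "interior d \<inter> interior e = {}" if "d \<in> T1" "e \<in> T1" "d \<noteq> e" for d e
  proof -
    obtain d' e' where *: "d' \<in> T" "e' \<in> T" "d = homothet s v d'" "e = homothet s v e'"
      using \<open>d \<in> T1\<close> \<open>e \<in> T1\<close> unfolding T1_eq by blast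
    then have "interior d' \<inter> interior e' = {}"
      using pairwiseD[OF disjT] \<open>d \<noteq> e\<close> by blast
    moreover have "inj (\<lambda>x. s *\<^sub>R x + v)"
      using \<open>0 < s\<close> by (auto simp: inj_def)
    moreover have "s \<noteq> 0" using \<open>0 < s\<close> by simp
    ultimately show ?thesis
      by (simp add: *(3,4) interior_homothet) (simp add: homothet_def image_Int[symmetric])
  qed
  have interior_if: "x \<in> interior d" if "x \<in> d" "x \<notin> N" "d \<in> T1" for x d
    using that closed[of d] by (auto simp: N_def frontier_def closure_closed)
  have "\<Union>T1 = UNIV"
  proof -
    have "x \<in> \<Union>T1" for x
    proof -
      obtain d where "d \<in> T" "(1 / s) *\<^sub>R (x - v) \<in> d" using \<open>\<Union>T = UNIV\<close> by blast
      then have "s *\<^sub>R ((1 / s) *\<^sub>R (x - v)) + v \<in> homothet s v d"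
        by (intro homothetI)
      then show ?thesis using \<open>d \<in> T\<close> \<open>0 < s\<close> by (auto simp: T1_eq)
    qed
    then show ?thesis by blast
  qed
  obtain a where a: "\<And>x. x \<notin> N \<Longrightarrow>
      indicat_real c x = (\<Sum>g | g \<in> chi T1 \<and> g x \<noteq> 0. a g * g x)"
    using ref[of "indicat_real c"] \<open>c \<in> T\<close> by (auto simp: chi_def N_def T1_def)
  have a_cell: "indicat_real c x = a (indicat_real d)" if "x \<in> interior d" "x \<notin> N" "d \<in> T1" for x d
  proof -
    have "x \<in> d" using that interior_subset by blast
    have "{g. g \<in> chi T1 \<and> g x \<noteq> 0} = {indicat_real d}"
    proof
      show "{g. g \<in> chi T1 \<and> g x \<noteq> 0} \<subseteq> {indicat_real d}"
      proof
        fix g assume "g \<in> {g. g \<in> chi T1 \<and> g x \<noteq> 0}"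
        then obtain e where e: "e \<in> T1" "g = indicat_real e" "x \<in> e"
          by (auto simp: chi_def indicator_def split: if_splits)
        then have "d = e"
          using disjT1[of d e] interior_if that by blast
        then show "g \<in> {indicat_real d}" using e by simp
      qed
    qed (use \<open>x \<in> d\<close> \<open>d \<in> T1\<close> in \<open>auto simp: chi_def\<close>)
    then show ?thesis using a[OF \<open>x \<notin> N\<close>] \<open>x \<in> d\<close> by simp
  qed
  have inside: "d \<subseteq> c" if "d \<in> T1" and meets: "interior d \<inter> interior c \<noteq> {}" for d
  proof (rule ccontr)
    assume "\<not> d \<subseteq> c"
    obtain u where u: "d = homothet s u c" using T1_cell \<open>d \<in> T1\<close> by blast
    have "d = closure (interior d)"
      using cl \<open>0 < s\<close> by (simp add: u interior_homothet closure_homothet)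
    moreover have "closed c" using closed \<open>c \<in> T\<close> by blast
    ultimately have "\<not> interior d \<subseteq> c"
      using \<open>\<not> d \<subseteq> c\<close> closure_minimal by metis
    \<comment> \<open>The coefficient of \<open>d\<close> would have to be 0 because of
      \<open>y\<close> and 1 because of \<open>x\<close>.\<close>
    then obtain y where y: "y \<in> interior d - c" "y \<notin> N"
      using dense[of "interior d - c"] \<open>closed c\<close> by (auto simp: open_Diff)
    obtain x where x: "x \<in> interior d \<inter> interior c" "x \<notin> N"
      using dense[OF open_Int[OF open_interior open_interior] meets] by blast
    have "x \<in> c" using x interior_subset by blast
    then show False
      using a_cell[of x d] a_cell[of y d] x y \<open>d \<in> T1\<close> by auto
  qed
  define D where "D = {d \<in> T1. d \<subseteq> c}"
  define rep where "rep d = (SOME u. d = homothet s u c)" for d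
  have rep: "homothet s (rep d) c = d" if "d \<in> D" for d
    using T1_cell[of d] that unfolding D_def rep_def by (metis (mono_tags, lifting) mem_Collect_eq someI)
  have pw: "pairwise (\<lambda>u v. interior (homothet s u c) \<inter> interior (homothet s v c) = {}) (rep ` D)"
  proof (rule pairwise_imageI)
    fix d e assume "d \<in> D" "e \<in> D" "d \<noteq> e"
    then show "interior (homothet s (rep d) c) \<inter> interior (homothet s (rep e) c) = {}"
      using disjT1[of d e] rep by (simp add: D_def)
  qed
  have fin: "finite (rep ` D)"
    by (rule finite_homothets_inside[OF \<open>bounded c\<close> ne _ pw])
      (use \<open>0 < s\<close> rep in \<open>auto simp: D_def\<close>)
  moreover have "inj_on rep D"
    by (rule inj_on_inverseI[of _ "\<lambda>u. homothet s u c"]) (rule rep)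
  ultimately have "finite D"
    by (simp add: finite_image_iff)
  \<comment> \<open>The fine cells in \<open>D\<close> cover a dense part of the interior of
    \<open>c\<close>; being finitely many, they have a closed union, which then contains all of
    \<open>c\<close>.\<close>
  have "interior c \<subseteq> closure (interior c \<inter> - N)"
    using open_Int_closure_subset[of "interior c" "- N"] \<open>closure (- N) = UNIV\<close> by simp
  also have "\<dots> \<subseteq> closure (\<Union>D)"
  proof (rule closure_mono, rule subsetI)
    fix x assume x: "x \<in> interior c \<inter> - N"
    obtain d where "d \<in> T1" "x \<in> d" using \<open>\<Union>T1 = UNIV\<close> by blast
    then have "x \<in> interior d" using interior_if x by blast
    then have "d \<subseteq> c" using inside \<open>d \<in> T1\<close> x by blast
    then show "x \<in> \<Union>D" using \<open>d \<in> T1\<close> \<open>x \<in> d\<close> by (auto simp: D_def)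
  qed
  also have "\<dots> = \<Union>D"
    using \<open>finite D\<close> closed by (intro closure_closed closed_Union) (auto simp: D_def)
  finally have "c \<subseteq> \<Union>D"
    by (subst cl, intro closure_minimal closed_Union) (use \<open>finite D\<close> closed in \<open>auto simp: D_def\<close>)
  then have "c = \<Union>D"
    unfolding D_def by blast
  also have "\<Union>D = (\<Union>u\<in>rep ` D. homothet s u c)"
    using rep by simp
  finally have "c = (\<Union>u\<in>rep ` D. homothet s u c)" .
  then have "subdivision c s (rep ` D)"
    using fin pw by (simp add: subdivision_def)
  then show thesis using that s by blast
qed

section \<open>Local cones of polyhedral sets\<close>

text \<open>Induction on the hyperplanes: if \<open>p\<close> lies on the new one, it is moved a
  little towards a point \<open>q\<close> of \<open>S\<close> off it. A small move keeps
  \<open>p\<close> off the finitely many earlier hyperplanes, and convexity keeps it in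
  \<open>S\<close>.\<close>

lemma convex_avoiding_point:
  fixes S :: "'a::real_inner set" and A :: "('a \<times> real) set"
  assumes "finite A" "convex S" "S \<noteq> {}"
    and "\<And>a b. (a, b) \<in> A \<Longrightarrow> \<exists>x\<in>S. a \<bullet> x \<noteq> b"
  shows "\<exists>p\<in>S. \<forall>(a, b)\<in>A. a \<bullet> p \<noteq> b"
  using assms(1,4)
proof (induction A rule: finite_induct)
  case empty
  then show ?case using \<open>S \<noteq> {}\<close> by auto
next
  case (insert ab A)
  obtain a b where ab: "ab = (a, b)" by fastforce
  obtain p where p: "p \<in> S" "\<forall>(a, b)\<in>A. a \<bullet> p \<noteq> b"
    using insert by auto
  obtain q where q: "q \<in> S" "a \<bullet> q \<noteq> b"
    using insert.prems ab by blast
  show ?case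
  proof (cases "a \<bullet> p = b")
    case False
    then show ?thesis using p ab by auto
  next
    case True
    define x where "x t = p + t *\<^sub>R (q - p)" for t
    have "eventually (\<lambda>t. \<forall>(a, b)\<in>A. a \<bullet> x t \<noteq> b) (at_right 0)"
    proof (rule eventually_ball_finite[OF insert.hyps(1)], clarify)
      fix a' b' assume "(a', b') \<in> A"
      then have "a' \<bullet> x 0 \<noteq> b'" using p by (auto simp: x_def)
      moreover have "((\<lambda>t. a' \<bullet> x t) \<longlongrightarrow> a' \<bullet> x 0) (at_right 0)"
        unfolding x_def by (auto intro!: tendsto_eq_intros)
      ultimately show "eventually (\<lambda>t. a' \<bullet> x t \<noteq> b') (at_right 0)"
        by (rule tendsto_imp_eventually_ne[rotated])
    qed
    moreover have "eventually (\<lambda>t::real. t \<in> {0<..<1}) (at_right 0)"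
      by (rule eventually_at_right_real) simp
    ultimately have "eventually (\<lambda>t. (\<forall>(a, b)\<in>A. a \<bullet> x t \<noteq> b) \<and> t \<in> {0<..<1}) (at_right 0)"
      by (rule eventually_conj)
    then have "\<exists>t. (\<forall>(a, b)\<in>A. a \<bullet> x t \<noteq> b) \<and> t \<in> {0<..<1}"
      by (rule eventually_happens'[OF trivial_limit_at_right_real])
    then obtain t where t: "\<forall>(a, b)\<in>A. a \<bullet> x t \<noteq> b" "0 < t" "t < 1"
      by auto
    have "x t = (1 - t) *\<^sub>R p + t *\<^sub>R q"
      by (simp add: x_def algebra_simps)
    then have "x t \<in> S"
      using convexD_alt[OF \<open>convex S\<close> p(1) q(1), of t] t by simp
    moreover have "a \<bullet> x t = b + t * (a \<bullet> q - b)"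
      using True by (simp add: x_def inner_add_right inner_diff_right)
    ultimately show ?thesis
      using t ab q by (intro bexI[of _ "x t"]) auto
  qed
qed

lemma polytope_halfspaces:
  fixes P :: "'a::euclidean_space set"
  assumes "polytope P"
  shows "\<exists>A. finite A \<and> (\<forall>x. x \<in> P \<longleftrightarrow> (\<forall>(a, b)\<in>A. a \<bullet> x \<le> b))"
proof -
  obtain F where F: "finite F" "P = \<Inter>F" "\<And>h. h \<in> F \<Longrightarrow> \<exists>a b. a \<noteq> 0 \<and> h = {x. a \<bullet> x \<le> b}"
    using polytope_imp_polyhedron[OF assms] by (auto simp: polyhedron_def)
  then obtain f g where fg: "\<And>h. h \<in> F \<Longrightarrow> h = {x. f h \<bullet> x \<le> g h}"
    by metis
  have "x \<in> P \<longleftrightarrow> (\<forall>(a, b)\<in>(\<lambda>h. (f h, g h)) ` F. a \<bullet> x \<le> b)" for x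
    using F(2) fg by auto
  then show ?thesis
    using F(1) by (intro exI[of _ "(\<lambda>h. (f h, g h)) ` F"]) simp
qed

text \<open>The point \<open>p\<close> is chosen off all bounding hyperplanes that do not contain \<open>S\<close>; the
  remaining ones through \<open>p\<close> are parallel to \<open>S\<close>.\<close>

lemma polytopes_conic_at_generic_point:
  fixes S :: "'a::euclidean_space set"
  assumes "finite \<P>" and poly: "\<And>P. P \<in> \<P> \<Longrightarrow> polytope P" and S: "convex S" "S \<noteq> {}"
  obtains p K r where "p \<in> S" "0 < r" "closed K"
    "\<And>t v. 0 < t \<Longrightarrow> v \<in> K \<Longrightarrow> t *\<^sub>R v \<in> K"
    "\<And>v l. v \<in> K \<Longrightarrow> l \<in> span ((\<lambda>x. x - p) ` S) \<Longrightarrow> v + l \<in> K"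
    "\<And>y. y \<in> ball p r \<Longrightarrow> y \<in> \<Union>\<P> \<longleftrightarrow> y - p \<in> K"
proof -
  obtain H where H: "\<And>P. P \<in> \<P> \<Longrightarrow> finite (H P)"
      "\<And>P x. P \<in> \<P> \<Longrightarrow> x \<in> P \<longleftrightarrow> (\<forall>(a, b)\<in>H P. a \<bullet> x \<le> b)"
    using polytope_halfspaces[OF poly] by metis
  define A where "A = (\<Union>P\<in>\<P>. H P)"
  have "finite A" using H \<open>finite \<P>\<close> by (auto simp: A_def)
  then have "finite {(a, b) \<in> A. \<exists>x\<in>S. a \<bullet> x \<noteq> b}"
    by (rule rev_finite_subset) auto
  then obtain p where p: "p \<in> S" "\<forall>(a, b)\<in>{(a, b) \<in> A. \<exists>x\<in>S. a \<bullet> x \<noteq> b}. a \<bullet> p \<noteq> b"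
    using convex_avoiding_point[of "{(a, b) \<in> A. \<exists>x\<in>S. a \<bullet> x \<noteq> b}" S] S by blast
  have tight: "a \<bullet> x = b" if "(a, b) \<in> A" "a \<bullet> p = b" "x \<in> S" for a b x
    using that p(2) by blast
  have tight_span: "a \<bullet> l = 0" if "(a, b) \<in> A" "a \<bullet> p = b" "l \<in> span ((\<lambda>x. x - p) ` S)" for a b l
    using that(3)
  proof (induction rule: span_induct)
    case base
    show ?case by (rule subspace_hyperplane)
  next
    case (step x)
    then show ?case using tight[OF that(1,2)] that(2) by (auto simp: inner_diff_right)
  qed
  \<comment> \<open>Inequalities that are strict at \<open>p\<close>, whether satisfied or violated,
    stay so in a whole ball; only those with equality at \<open>p\<close> matter there.\<close>
  have "eventually (\<lambda>y. \<forall>(a, b)\<in>A. (a \<bullet> p < b \<longrightarrow> a \<bullet> y < b) \<and> (b < a \<bullet> p \<longrightarrow> b < a \<bullet> y)) (nhds p)"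
  proof (rule eventually_ball_finite[OF \<open>finite A\<close>], clarify)
    fix a b
    have lim: "((\<lambda>y. a \<bullet> y) \<longlongrightarrow> a \<bullet> p) (nhds p)"
      by (intro tendsto_intros filterlim_ident)
    show "eventually (\<lambda>y. (a \<bullet> p < b \<longrightarrow> a \<bullet> y < b) \<and> (b < a \<bullet> p \<longrightarrow> b < a \<bullet> y)) (nhds p)"
      using order_tendstoD[OF lim] by (cases "a \<bullet> p" b rule: linorder_cases) auto
  qed
  then obtain r where "0 < r" and r_all: "\<forall>y. dist y p < r \<longrightarrow>
      (\<forall>(a, b)\<in>A. (a \<bullet> p < b \<longrightarrow> a \<bullet> y < b) \<and> (b < a \<bullet> p \<longrightarrow> b < a \<bullet> y))"
    unfolding eventually_nhds_metric by blast
  have r: "(a \<bullet> p < b \<longrightarrow> a \<bullet> y < b) \<and> (b < a \<bullet> p \<longrightarrow> b < a \<bullet> y)"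
    if "y \<in> ball p r" "(a, b) \<in> A" for y a b
    using r_all that by (auto simp: dist_commute)
  \<comment> \<open>The union of the tangent cones at \<open>p\<close> of the polytopes through
    \<open>p\<close>. Every other polytope has an inequality that is violated at \<open>p\<close>
    and so misses the ball.\<close>
  define K where "K = (\<Union>P\<in>{P \<in> \<P>. p \<in> P}. \<Inter>(a, b)\<in>{(a, b) \<in> H P. a \<bullet> p = b}. {v. a \<bullet> v \<le> 0})"
  have memK: "v \<in> K \<longleftrightarrow> (\<exists>P\<in>\<P>. p \<in> P \<and> (\<forall>(a, b)\<in>H P. a \<bullet> p = b \<longrightarrow> a \<bullet> v \<le> 0))" for v
    by (auto simp: K_def)
  show thesis
  proof (rule that[OF p(1) \<open>0 < r\<close>])
    show "closed K"
      unfolding K_def using \<open>finite \<P>\<close> by (intro closed_UN) (auto intro!: closed_INT closed_halfspace_le)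
    show "t *\<^sub>R v \<in> K" if "0 < t" "v \<in> K" for t v
      using that by (fastforce simp: memK mult_le_0_iff)
    show "v + l \<in> K" if "v \<in> K" "l \<in> span ((\<lambda>x. x - p) ` S)" for v l
    proof -
      obtain P where P: "P \<in> \<P>" "p \<in> P" "\<forall>(a, b)\<in>H P. a \<bullet> p = b \<longrightarrow> a \<bullet> v \<le> 0"
        using \<open>v \<in> K\<close> memK by blast
      have "a \<bullet> (v + l) \<le> 0" if ab: "(a, b) \<in> H P" "a \<bullet> p = b" for a b
      proof -
        have "a \<bullet> l = 0"
          using tight_span[OF _ ab(2) \<open>l \<in> _\<close>] ab(1) \<open>P \<in> \<P>\<close> by (auto simp: A_def)
        moreover have "a \<bullet> v \<le> 0" using P(3) ab by blast
        ultimately show ?thesis by (simp add: inner_add_right)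
      qed
      then show ?thesis using P memK by blast
    qed
    show "y \<in> \<Union>\<P> \<longleftrightarrow> y - p \<in> K" if y: "y \<in> ball p r" for y
    proof -
      have "y \<in> P \<longleftrightarrow> p \<in> P \<and> (\<forall>(a, b)\<in>H P. a \<bullet> p = b \<longrightarrow> a \<bullet> (y - p) \<le> 0)" if "P \<in> \<P>" for P
      proof -
        have "(a \<bullet> y \<le> b) \<longleftrightarrow> a \<bullet> p \<le> b \<and> (a \<bullet> p = b \<longrightarrow> a \<bullet> (y - p) \<le> 0)" if "(a, b) \<in> H P" for a b
        proof -
          have "(a, b) \<in> A" using that \<open>P \<in> \<P>\<close> by (auto simp: A_def)
          then show ?thesis
            using r[OF y, of a b] by (cases "a \<bullet> p" b rule: linorder_cases) (auto simp: inner_diff_right)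
        qed
        then have "(\<forall>(a, b)\<in>H P. a \<bullet> y \<le> b) \<longleftrightarrow>
            (\<forall>(a, b)\<in>H P. a \<bullet> p \<le> b \<and> (a \<bullet> p = b \<longrightarrow> a \<bullet> (y - p) \<le> 0))"
          by (intro ball_cong refl) (simp add: case_prod_beta)
        also have "\<dots> \<longleftrightarrow> (\<forall>(a, b)\<in>H P. a \<bullet> p \<le> b) \<and>
            (\<forall>(a, b)\<in>H P. a \<bullet> p = b \<longrightarrow> a \<bullet> (y - p) \<le> 0)"
          by (simp add: case_prod_beta ball_conj_distrib)
        finally show ?thesis
          by (simp only: H(2)[OF that])
      qed
      then show ?thesis using memK by auto
    qed
  qed
qed

section \<open>Cells below a hyperplane that drop from it by a fixed vector\<close>

text \<open>Pigeonhole: one of the finitely many sets is met by the ray at arbitrarily small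
  parameters, and being closed it contains the origin \<open>q\<close> of the ray.\<close>

lemma cluster_cell:
  fixes q :: "'a::real_normed_vector"
  assumes "finite F" and closed: "\<And>M. M \<in> F \<Longrightarrow> closed M"
    and cover: "eventually (\<lambda>\<epsilon>. q + \<epsilon> *\<^sub>R w \<in> \<Union>F) (at_right 0)"
  obtains M \<epsilon> where "M \<in> F" "q \<in> M" "0 < \<epsilon>" "q + \<epsilon> *\<^sub>R w \<in> M"
proof -
  have "frequently (\<lambda>\<epsilon>. \<exists>M\<in>F. q + \<epsilon> *\<^sub>R w \<in> M) (at_right 0)"
    using cover by (intro eventually_frequently trivial_limit_at_right_real) simp
  then obtain M where M: "M \<in> F" "frequently (\<lambda>\<epsilon>. q + \<epsilon> *\<^sub>R w \<in> M) (at_right 0)"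
    using frequently_bex_finite[OF \<open>finite F\<close>, of "\<lambda>\<epsilon> M. q + \<epsilon> *\<^sub>R w \<in> M"] by blast
  have "((\<lambda>\<epsilon>. q + \<epsilon> *\<^sub>R w) \<longlongrightarrow> q) (at_right 0)"
    by (auto intro!: tendsto_eq_intros)
  then have "q \<in> M"
    using topological_tendstoD[of "\<lambda>\<epsilon>. q + \<epsilon> *\<^sub>R w" q "at_right 0" "- M"] closed[OF M(1)] M(2)
    by (auto simp: open_Compl frequently_def)
  moreover have "\<exists>\<epsilon>>0. q + \<epsilon> *\<^sub>R w \<in> M"
    using frequently_ex[OF frequently_eventually_conj[OF M(2) eventually_at_right_less[of 0]]] by blast
  ultimately show thesis using M(1) that by blast
qed

lemma eventually_ray_in_ball:
  fixes q :: "'a::real_normed_vector"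
  assumes "q \<in> ball p r"
  shows "eventually (\<lambda>\<epsilon>. q + \<epsilon> *\<^sub>R w \<in> ball p r) (at_right 0)"
proof (rule topological_tendstoD)
  show "((\<lambda>\<epsilon>. q + \<epsilon> *\<^sub>R w) \<longlongrightarrow> q) (at_right 0)"
    by (auto intro!: tendsto_eq_intros)
qed (use assms in auto)

lemma cone_interior_scaleR:
  fixes K :: "'a::euclidean_space set"
  assumes "\<And>t v. 0 < t \<Longrightarrow> v \<in> K \<Longrightarrow> t *\<^sub>R v \<in> K" and "v \<in> interior K" "0 < t"
  shows "t *\<^sub>R v \<in> interior K"
proof -
  have "homothet t 0 K \<subseteq> K"
    using assms(1,3) by (auto simp: homothet_def)
  then have "homothet t 0 (interior K) \<subseteq> interior K"
    using interior_mono[of "homothet t 0 K" K] \<open>0 < t\<close> by (simp add: interior_homothet)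
  then show ?thesis
    using homothetI[OF assms(2), of t 0] by auto
qed

text \<open>Collects what the reflection and refinability provide. The reflected cell is
  \<open>c\<close> shifted by \<open>\<tau> *\<^sub>R n\<close>, and the reflection fixes the
  hyperplane; on points of the hyperplane this reads as \<open>drop\<close>.\<close>

locale capped_cell =
  fixes c :: "'a::euclidean_space set" and n :: 'a and h \<tau> :: real
  assumes bounded: "bounded c"
    and closure_interior: "c = closure (interior c)"
    and connected: "connected (interior c)"
    and norm_n: "norm n = 1"
    and below: "x \<in> c \<Longrightarrow> n \<bullet> x \<le> h"
    and top: "\<exists>x\<in>c. n \<bullet> x = h"
    and height_pos: "0 < \<tau>"
    and drop: "x \<in> c \<Longrightarrow> n \<bullet> x = h \<Longrightarrow> x - \<tau> *\<^sub>R n \<in> c"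
    and small_subdivision: "0 < \<delta> \<Longrightarrow> \<exists>t U. 0 < t \<and> t < \<delta> \<and> subdivision c t U"
begin

lemma inner_n: "n \<bullet> n = 1"
  using norm_n by (simp add: norm_eq_1)

lemma closed_homothet: "closed (homothet t u c)"
  by (subst closure_interior) (simp add: closure_homothet[symmetric])

lemma closure_interior_homothet: "0 < t \<Longrightarrow> homothet t u c = closure (interior (homothet t u c))"
  using closure_interior by (simp add: interior_homothet closure_homothet)

lemma interior_strictly_below: "x \<in> interior c \<Longrightarrow> n \<bullet> x < h"
proof -
  assume "x \<in> interior c"
  then have "x \<in> interior {x. n \<bullet> x \<le> h}"
    by (rule subsetD[OF interior_mono, rotated]) (auto intro: below)
  moreover have "n \<noteq> 0" using norm_n by auto
  ultimately show "n \<bullet> x < h" by (simp add: interior_halfspace_le)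
qed

lemma small_homothets:
  assumes "0 < \<rho>"
  obtains \<delta> where "0 < \<delta>"
    "\<And>t u x y. 0 < t \<Longrightarrow> t < \<delta> \<Longrightarrow> x \<in> homothet t u c \<Longrightarrow> y \<in> homothet t u c \<Longrightarrow> dist x y < \<rho>"
proof -
  obtain B where B: "0 < B" "\<And>x. x \<in> c \<Longrightarrow> norm x \<le> B"
    using bounded by (auto simp: bounded_pos)
  show thesis
  \<comment> \<open>The diameter of \<open>c\<close> is at most \<open>2 * B\<close>, and that of a
    copy scales with its ratio.\<close>
  proof (rule that[of "\<rho> / (2 * B)"])
    fix t u x y assume t: "0 < t" "t < \<rho> / (2 * B)" and "x \<in> homothet t u c" "y \<in> homothet t u c"
    then obtain a b where ab: "a \<in> c" "b \<in> c" "x = t *\<^sub>R a + u" "y = t *\<^sub>R b + u"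
      by (auto simp: homothet_def)
    have "dist x y = t * norm (a - b)"
      using t by (simp add: ab dist_norm scaleR_diff_right[symmetric] del: scaleR_diff_right)
    also have "\<dots> \<le> t * (2 * B)"
      using t B(2)[OF ab(1)] B(2)[OF ab(2)] norm_triangle_ineq4[of a b] by (intro mult_left_mono) auto
    also have "\<dots> < \<rho>"
      using t B(1) by (simp add: field_simps)
    finally show "dist x y < \<rho>" .
  qed (use assms B in auto)
qed

text \<open>The copy maps highest points of \<open>c\<close> to its own highest points, and these
  cannot lie above \<open>h\<close>. A point of the copy at height \<open>h\<close> thus comes from
  a highest point of \<open>c\<close>.\<close>

lemma top_of_homothet:
  assumes "homothet t u c \<subseteq> c" "0 < t" "y \<in> c" "n \<bullet> (t *\<^sub>R y + u) = h"
  shows "n \<bullet> y = h"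
proof -
  obtain x where x: "x \<in> c" "n \<bullet> x = h" using top by blast
  have "n \<bullet> (t *\<^sub>R x + u) \<le> h"
    using below assms(1) homothetI[OF x(1)] by blast
  then have "t * h \<le> t * (n \<bullet> y)"
    using assms(4) x(2) by (simp add: inner_add_right)
  then have "h \<le> n \<bullet> y" using \<open>0 < t\<close> by simp
  then show ?thesis using below[OF assms(3)] by simp
qed

lemma drop_homothet:
  assumes "homothet t u c \<subseteq> c" "0 < t" "q \<in> homothet t u c" "n \<bullet> q = h"
  shows "q - (t * \<tau>) *\<^sub>R n \<in> homothet t u c"
proof -
  obtain y where y: "y \<in> c" "q = t *\<^sub>R y + u" using assms(3) by (auto simp: homothet_def)
  then have "y - \<tau> *\<^sub>R n \<in> c"
    using top_of_homothet[OF assms(1,2) y(1)] assms(4) drop by simp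
  from homothetI[OF this, of t u] show ?thesis
    by (simp add: y(2) algebra_simps)
qed

text \<open>If the ray from \<open>w\<close> in direction \<open>- n\<close> left \<open>K\<close> at \<open>u\<close>, the half-hyperplane spanned by
  \<open>u\<close> and the invariant directions would separate \<open>w\<close> from \<open>- n\<close> inside the lower half-space,
  although a small cell at \<open>p\<close> has a connected interior that avoids this half-hyperplane and
  reaches to both sides. The sign of \<open>Y\<close> tells the two sides apart.\<close>

lemma cone_shifts_down:
  assumes e: "norm e = 1" "n \<bullet> e = 0"
    and cone: "\<And>t v. 0 < t \<Longrightarrow> v \<in> K \<Longrightarrow> t *\<^sub>R v \<in> K"
    and inv: "\<And>v l. v \<in> K \<Longrightarrow> n \<bullet> l = 0 \<Longrightarrow> e \<bullet> l = 0 \<Longrightarrow> v + l \<in> K"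
    and p: "n \<bullet> p = h" and "0 < r"
    and loc: "\<And>y. y \<in> ball p r \<Longrightarrow> y \<in> c \<longleftrightarrow> y - p \<in> K"
    and w: "w \<in> K" "n \<bullet> w < 0" and "0 \<le> \<mu>"
  shows "w - \<mu> *\<^sub>R n \<in> K"
proof (rule ccontr)
  define u where "u = w - \<mu> *\<^sub>R n"
  assume "w - \<mu> *\<^sub>R n \<notin> K"
  then have "u \<notin> K" by (simp add: u_def)
  have "0 < \<mu>"
    using w \<open>0 \<le> \<mu>\<close> \<open>u \<notin> K\<close> by (cases "\<mu> = 0") (auto simp: u_def)
  have e_n: "e \<bullet> n = 0" "e \<bullet> e = 1" using e by (auto simp: inner_commute norm_eq_1)
  have n_u: "n \<bullet> u = n \<bullet> w - \<mu>" and e_u: "e \<bullet> u = e \<bullet> w"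
    by (simp_all add: u_def inner_diff_right inner_n e_n)
  have "n \<bullet> u < 0" using n_u w \<open>0 < \<mu>\<close> by simp
  \<comment> \<open>The equation makes the projections of \<open>v\<close> and \<open>u\<close> to
    the plane of \<open>n\<close> and \<open>e\<close> collinear, and the negative heights make the
    factor positive. Hence \<open>u\<close> differs from a positive multiple of \<open>v\<close> by
    an invariant direction.\<close>
  have parallel: "v \<notin> K" if "n \<bullet> v < 0" "(n \<bullet> v) * (e \<bullet> u) = (n \<bullet> u) * (e \<bullet> v)" for v
  proof
    assume "v \<in> K"
    define t where "t = (n \<bullet> u) / (n \<bullet> v)"
    have "0 < t" using that \<open>n \<bullet> u < 0\<close> by (simp add: t_def divide_neg_neg)
    then have "t *\<^sub>R v + (u - t *\<^sub>R v) \<in> K"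
      using that \<open>v \<in> K\<close> by (intro inv cone) (auto simp: t_def inner_diff_right field_simps)
    then show False using \<open>u \<notin> K\<close> by simp
  qed
  \<comment> \<open>The determinant of the projections of \<open>v\<close> and \<open>u\<close>,
    which vanishes exactly on multiples of \<open>u\<close> there. The factor
    \<open>e \<bullet> w\<close> makes \<open>Y w\<close> positive and \<open>Y (- n)\<close>
    negative on whichever side \<open>w\<close> lies.\<close>
  define Y where "Y v = (e \<bullet> w) * ((n \<bullet> v) * (e \<bullet> u) - (n \<bullet> u) * (e \<bullet> v))" for v
  \<comment> \<open>Otherwise \<open>w\<close> and \<open>u\<close> would both project to the ray of
    \<open>- n\<close>, against \<open>w \<in> K\<close>.\<close>
  have "e \<bullet> w \<noteq> 0"
    using parallel[of w] w by (auto simp: e_u)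
  obtain \<delta> where \<delta>: "0 < \<delta>" "\<And>t u x y. 0 < t \<Longrightarrow> t < \<delta> \<Longrightarrow> x \<in> homothet t u c \<Longrightarrow> y \<in> homothet t u c \<Longrightarrow> dist x y < r"
    using small_homothets[OF \<open>0 < r\<close>] by blast
  obtain t U where t: "0 < t" "t < \<delta>" and U: "subdivision c t U"
    using small_subdivision[OF \<delta>(1)] by blast
  have "eventually (\<lambda>\<epsilon>. p + \<epsilon> *\<^sub>R w \<in> \<Union>((\<lambda>u. homothet t u c) ` U)) (at_right 0)"
  proof -
    have "eventually (\<lambda>\<epsilon>. p + \<epsilon> *\<^sub>R w \<in> ball p r \<and> 0 < \<epsilon>) (at_right 0)"
      by (intro eventually_conj eventually_ray_in_ball eventually_at_right_less) (use \<open>0 < r\<close> in simp)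
    then show ?thesis
    proof (rule eventually_mono)
      fix \<epsilon> assume "p + \<epsilon> *\<^sub>R w \<in> ball p r \<and> 0 < \<epsilon>"
      then have "p + \<epsilon> *\<^sub>R w \<in> c" using loc cone w by simp
      then show "p + \<epsilon> *\<^sub>R w \<in> \<Union>((\<lambda>u. homothet t u c) ` U)"
        using U unfolding subdivision_def by blast
    qed
  qed
  \<comment> \<open>The small copy \<open>M\<close> contains \<open>p\<close> and also a point in
    direction \<open>w\<close>, where \<open>Y\<close> is positive.\<close>
  then obtain M \<epsilon> where M: "M \<in> (\<lambda>u. homothet t u c) ` U" "p \<in> M" "0 < \<epsilon>" "p + \<epsilon> *\<^sub>R w \<in> M"
    using U by (elim cluster_cell[rotated 2]) (auto simp: subdivision_def closed_homothet)
  then obtain u' where u': "u' \<in> U" "M = homothet t u' c" by blast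
  have "M \<subseteq> c" using subdivision_subset[OF U] u' by blast
  have "M \<subseteq> ball p r" using \<delta>(2)[OF t] M(2) u'(2) by auto
  have sign: "Y (y - p) \<noteq> 0" if "y \<in> interior M" for y
  proof -
    have "y \<in> M" "y \<in> interior c"
      using that interior_subset interior_mono[OF \<open>M \<subseteq> c\<close>] by auto
    then have "y - p \<in> K"
      using loc \<open>M \<subseteq> c\<close> \<open>M \<subseteq> ball p r\<close> by blast
    moreover have "n \<bullet> (y - p) < 0"
      using interior_strictly_below[OF \<open>y \<in> interior c\<close>] p by (simp add: inner_diff_right)
    ultimately show ?thesis
      using parallel[of "y - p"] \<open>e \<bullet> w \<noteq> 0\<close> by (auto simp: Y_def)
  qed
  have opens: "open {y. 0 < Y (y - p)}" "open {y. Y (y - p) < 0}"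
    by (auto intro!: open_Collect_less continuous_intros simp: Y_def)
  \<comment> \<open>An open set that meets \<open>M\<close> meets its interior; this moves the two
    sides of \<open>Y\<close> between \<open>M\<close> and its connected interior.\<close>
  have dense: "A \<inter> interior M = {} \<Longrightarrow> A \<inter> M = {}" if "open A" for A
    using open_Int_closure_eq_empty[OF that, of "interior M"] closure_interior_homothet[OF \<open>0 < t\<close>] u'(2) by simp
  have "connected (homothet t u' (interior c))"
    unfolding homothet_def by (intro connected_continuous_image connected continuous_intros)
  then have conn: "connected (interior M)"
    using u'(2) t by (simp add: interior_homothet)
  have "Y w = \<mu> * (e \<bullet> w)\<^sup>2"
    by (simp add: Y_def n_u e_u algebra_simps power2_eq_square)
  moreover have "Y (\<epsilon> *\<^sub>R w) = \<epsilon> * Y w"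
    by (simp add: Y_def algebra_simps)
  ultimately have "p + \<epsilon> *\<^sub>R w \<in> {y. 0 < Y (y - p)}"
    using \<open>0 < \<mu>\<close> \<open>0 < \<epsilon>\<close> \<open>e \<bullet> w \<noteq> 0\<close> by simp
  then have "{y. 0 < Y (y - p)} \<inter> interior M \<noteq> {}"
    using M(4) dense[OF opens(1)] by blast
  moreover have "interior M \<subseteq> {y. 0 < Y (y - p)} \<union> {y. Y (y - p) < 0}"
  proof
    fix y assume "y \<in> interior M"
    then show "y \<in> {y. 0 < Y (y - p)} \<union> {y. Y (y - p) < 0}"
      using sign[of y] by auto
  qed
  moreover have "{y. 0 < Y (y - p)} \<inter> {y. Y (y - p) < 0} \<inter> interior M = {}"
    by auto
  ultimately have "{y. Y (y - p) < 0} \<inter> interior M = {}"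
    using connectedD[OF conn opens] by satx
  then have "{y. Y (y - p) < 0} \<inter> M = {}"
    by (rule dense[OF opens(2)])
  \<comment> \<open>Since \<open>M\<close> touches the hyperplane at \<open>p\<close>, it also
    contains a point straight below \<open>p\<close>, where \<open>Y\<close> is negative.\<close>
  moreover have "p - (t * \<tau>) *\<^sub>R n \<in> M"
    using drop_homothet[of t u' p] M(2) u' \<open>M \<subseteq> c\<close> t p by simp
  moreover have "Y (p - (t * \<tau>) *\<^sub>R n - p) = - (t * \<tau> * (e \<bullet> w)\<^sup>2)"
    by (simp add: Y_def e_n inner_n e_u power2_eq_square)
  moreover have "0 < t * \<tau> * (e \<bullet> w)\<^sup>2"
    using t height_pos \<open>e \<bullet> w \<noteq> 0\<close> by simp
  ultimately have "Y (p - (t * \<tau>) *\<^sub>R n - p) < 0" "p - (t * \<tau>) *\<^sub>R n \<in> M"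
      "{y. Y (y - p) < 0} \<inter> M = {}"
    by linarith+
  then show False by blast
qed

text \<open>A copy of \<open>p\<close> appears on the flat piece around \<open>z\<close>, where \<open>c\<close> fills the whole lower
  half-space; a direction \<open>\<gamma>\<close> missing from \<open>K\<close> must be covered by other cells.\<close>

lemma cone_is_halfspace:
  assumes "z \<in> c" "n \<bullet> z = h" "0 < \<rho>"
    and flat: "\<And>y. y \<in> ball z \<rho> \<Longrightarrow> y \<in> c \<longleftrightarrow> n \<bullet> y \<le> h"
    and cone: "\<And>t v. 0 < t \<Longrightarrow> v \<in> K \<Longrightarrow> t *\<^sub>R v \<in> K"
    and p: "p \<in> c" "n \<bullet> p = h" and "0 < r"
    and loc: "\<And>y. y \<in> ball p r \<Longrightarrow> y \<in> c \<longleftrightarrow> y - p \<in> K"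
    and down: "- n \<in> interior K" and "n \<bullet> \<gamma> \<le> 0"
  shows "\<gamma> \<in> K"
proof (rule ccontr)
  assume "\<gamma> \<notin> K"
  obtain \<delta> where \<delta>: "0 < \<delta>" "\<And>t u x y. 0 < t \<Longrightarrow> t < \<delta> \<Longrightarrow> x \<in> homothet t u c \<Longrightarrow> y \<in> homothet t u c \<Longrightarrow> dist x y < \<rho>"
    using small_homothets[OF \<open>0 < \<rho>\<close>] by blast
  obtain t U where t: "0 < t" "t < \<delta>" and U: "subdivision c t U"
    using small_subdivision[OF \<delta>(1)] by blast
  obtain u where u: "u \<in> U" "z \<in> homothet t u c"
    using U \<open>z \<in> c\<close> unfolding subdivision_def by blast
  \<comment> \<open>\<open>g\<close> is a copy through \<open>z\<close> inside the ball where
    \<open>c\<close> is a half-space, and \<open>q\<close> is its image of \<open>p\<close>. As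
    \<open>z\<close> and \<open>p\<close> are at the top, \<open>q\<close> has height
    \<open>h\<close> too.\<close>
  define g where "g = homothet t u c"
  define q where "q = t *\<^sub>R p + u"
  have "g \<subseteq> c" using subdivision_subset[OF U u(1)] by (simp add: g_def)
  have "q \<in> g" using homothetI[OF p(1)] by (simp add: q_def g_def)
  then have "q \<in> ball z \<rho>" using \<delta>(2)[OF t u(2)] by (simp add: g_def)
  have "n \<bullet> q = h"
  proof -
    obtain y where y: "y \<in> c" "z = t *\<^sub>R y + u" using u(2) by (auto simp: homothet_def)
    then have "n \<bullet> y = h"
      using top_of_homothet[of t u y] \<open>g \<subseteq> c\<close> t \<open>n \<bullet> z = h\<close> by (simp add: g_def)
    then show ?thesis
      using y \<open>n \<bullet> z = h\<close> p(2) by (simp add: q_def inner_add_right)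
  qed
  have "0 < t * r" using t \<open>0 < r\<close> by simp
  obtain \<delta>' where \<delta>': "0 < \<delta>'" "\<And>s u x y. 0 < s \<Longrightarrow> s < \<delta>' \<Longrightarrow> x \<in> homothet s u c \<Longrightarrow> y \<in> homothet s u c \<Longrightarrow> dist x y < t * r"
    using small_homothets[OF \<open>0 < t * r\<close>] by blast
  \<comment> \<open>The bound \<open>\<delta>' / t\<close> keeps the copies of ratio
    \<open>t * s\<close> smaller than the image in \<open>g\<close> of the ball around
    \<open>p\<close>.\<close>
  obtain s V where s: "0 < s" "s < \<delta>' / t" and V: "subdivision c s V"
    using small_subdivision[of "\<delta>' / t"] \<delta>'(1) t by auto
  \<comment> \<open>The tiny pieces of all copies other than \<open>g\<close>. Near \<open>q\<close>
    the ray in direction \<open>\<gamma>\<close> stays in \<open>c\<close>, by flatness, but outside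
    \<open>g\<close>, because \<open>\<gamma> \<notin> K\<close>; so \<open>F\<close> covers
    it.\<close>
  define F where "F = (\<lambda>(u', v). homothet t u' (homothet s v c)) ` ((U - {u}) \<times> V)"
  have "eventually (\<lambda>\<epsilon>. q + \<epsilon> *\<^sub>R \<gamma> \<in> \<Union>F) (at_right 0)"
  proof -
    have "eventually (\<lambda>\<epsilon>. 0 < \<epsilon> \<and> q + \<epsilon> *\<^sub>R \<gamma> \<in> ball z \<rho> \<and> q + \<epsilon> *\<^sub>R \<gamma> \<in> ball q (t * r)) (at_right 0)"
      by (intro eventually_conj eventually_ray_in_ball eventually_at_right_less)
        (use \<open>0 < t * r\<close> \<open>q \<in> ball z \<rho>\<close> in auto)
    then show ?thesis
    proof (rule eventually_mono)
      fix \<epsilon> assume \<epsilon>: "0 < \<epsilon> \<and> q + \<epsilon> *\<^sub>R \<gamma> \<in> ball z \<rho> \<and> q + \<epsilon> *\<^sub>R \<gamma> \<in> ball q (t * r)"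
      then have "q + \<epsilon> *\<^sub>R \<gamma> \<in> c"
        using flat \<open>n \<bullet> q = h\<close> \<open>n \<bullet> \<gamma> \<le> 0\<close> by (simp add: inner_add_right mult_nonneg_nonpos)
      moreover have "q + \<epsilon> *\<^sub>R \<gamma> \<notin> g"
      proof
        assume "q + \<epsilon> *\<^sub>R \<gamma> \<in> g"
        then obtain y where y: "y \<in> c" "q + \<epsilon> *\<^sub>R \<gamma> = t *\<^sub>R y + u" by (auto simp: g_def homothet_def)
        then have "t *\<^sub>R (y - p) = \<epsilon> *\<^sub>R \<gamma>" by (simp add: q_def algebra_simps)
        then have "(1 / t) *\<^sub>R t *\<^sub>R (y - p) = (1 / t) *\<^sub>R \<epsilon> *\<^sub>R \<gamma>"
          by simp
        then have yp: "y - p = (\<epsilon> / t) *\<^sub>R \<gamma>"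
          using t by simp
        have "norm (\<epsilon> *\<^sub>R \<gamma>) < t * r"
          using \<epsilon> by (auto simp: dist_norm)
        then have "t * norm (y - p) < t * r"
          using t \<epsilon> by (simp add: yp)
        then have "norm (y - p) < r"
          using t by simp
        then have "y \<in> ball p r"
          by (simp add: dist_norm norm_minus_commute)
        then have "(\<epsilon> / t) *\<^sub>R \<gamma> \<in> K"
          using loc y(1) yp by metis
        moreover have "0 < t / \<epsilon>" using t \<epsilon> by simp
        ultimately have "(t / \<epsilon>) *\<^sub>R (\<epsilon> / t) *\<^sub>R \<gamma> \<in> K"
          by (rule cone[rotated])
        then show False using \<open>\<gamma> \<notin> K\<close> t \<epsilon> by simp
      qed
      ultimately obtain u' where u': "u' \<in> U - {u}" "q + \<epsilon> *\<^sub>R \<gamma> \<in> homothet t u' c"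
        using U unfolding subdivision_def g_def by blast
      moreover have "homothet t u' c = (\<Union>v\<in>V. homothet t u' (homothet s v c))"
        using V by (metis homothet_UN subdivision_def)
      ultimately show "q + \<epsilon> *\<^sub>R \<gamma> \<in> \<Union>F"
        unfolding F_def by force
    qed
  qed
  moreover have "finite F" using U V by (simp add: F_def subdivision_def)
  moreover have "closed M" if "M \<in> F" for M
    using that by (auto simp: F_def homothet_homothet closed_homothet)
  ultimately obtain M where "M \<in> F" "q \<in> M"
    using cluster_cell by metis
  then obtain u' v where uv: "u' \<in> U" "u' \<noteq> u" "v \<in> V" "M = homothet t u' (homothet s v c)"
    by (auto simp: F_def)
  have M: "M = homothet (t * s) (t *\<^sub>R v + u') c"
    using uv(4) by (simp add: homothet_homothet)
  have "0 < t * s" "t * s < \<delta>'" using t s by (auto simp: field_simps)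
  have "M \<subseteq> homothet t u' c"
    unfolding uv(4) by (intro homothet_mono subdivision_subset[OF V uv(3)])
  then have "M \<subseteq> c" using subdivision_subset[OF U uv(1)] by blast
  have disj: "interior M \<inter> interior g = {}"
    using interior_mono[OF \<open>M \<subseteq> homothet t u' c\<close>] U uv u(1)
    unfolding subdivision_def pairwise_def g_def by blast
  \<comment> \<open>The image of \<open>x\<close> in \<open>g\<close> is the point to which
    \<open>q\<close> drops in the tiny copy \<open>M\<close>. As \<open>- n\<close> is interior to
    \<open>K\<close>, \<open>x\<close> is interior to \<open>c\<close>, so \<open>M\<close> reaches
    into the interior of \<open>g\<close>.\<close>
  define x where "x = p - (s * \<tau>) *\<^sub>R n"
  have "t *\<^sub>R x + u = q - (t * s * \<tau>) *\<^sub>R n"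
    by (simp add: x_def q_def algebra_simps)
  then have xM: "t *\<^sub>R x + u \<in> M"
    using drop_homothet[of "t * s" _ q] \<open>M \<subseteq> c\<close> M \<open>0 < t * s\<close> \<open>q \<in> M\<close> \<open>n \<bullet> q = h\<close> by simp
  then have "dist q (t *\<^sub>R x + u) < t * r"
    using \<delta>'(2)[OF \<open>0 < t * s\<close> \<open>t * s < \<delta>'\<close>] \<open>q \<in> M\<close> unfolding M by blast
  then have "x \<in> ball p r"
    using t by (simp add: q_def dist_norm scaleR_diff_right[symmetric] del: scaleR_diff_right)
  moreover have "x - p \<in> interior K"
    using cone_interior_scaleR[OF cone down, of "s * \<tau>"] s height_pos by (simp add: x_def)
  moreover have "open (ball p r \<inter> (\<lambda>y. y - p) -` interior K)"
    by (intro open_Int open_ball open_vimage open_interior continuous_intros)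
  moreover have "ball p r \<inter> (\<lambda>y. y - p) -` interior K \<subseteq> c"
    using loc interior_subset by blast
  ultimately have "x \<in> interior c"
    by (intro interiorI[of "ball p r \<inter> (\<lambda>y. y - p) -` interior K"]) auto
  then have "t *\<^sub>R x + u \<in> interior g"
    using homothetI[of x "interior c" t u] t by (simp add: g_def interior_homothet)
  moreover have "M = closure (interior M)"
    using closure_interior_homothet[OF \<open>0 < t * s\<close>] M by simp
  ultimately show False
    using disj xM open_Int_closure_eq_empty[OF open_interior, of g "interior M"] by blast
qed

end

section \<open>Flat boundary points and reflections\<close>

lemma flat_atE:
  assumes "flat_at c x u"
  obtains r where "norm u = 1" "0 < r" "\<And>y. y \<in> ball x r \<Longrightarrow> y \<in> c \<longleftrightarrow> u \<bullet> (y - x) \<le> 0"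
  using assms unfolding flat_at_def by blast

lemma flat_atI:
  assumes "norm u = 1" "0 < r" "\<And>y. y \<in> ball x r \<Longrightarrow> y \<in> c \<longleftrightarrow> u \<bullet> (y - x) \<le> 0"
  shows "flat_at c x u"
  using assms unfolding flat_at_def by blast

lemma flat_at_mem: "flat_at c x u \<Longrightarrow> x \<in> c"
  by (elim flat_atE) simp

lemma flat_at_outward:
  assumes "flat_at c x u"
  shows "eventually (\<lambda>\<epsilon>. x + \<epsilon> *\<^sub>R u \<notin> c) (at_right 0)"
proof -
  obtain r where r: "norm u = 1" "0 < r" "\<And>y. y \<in> ball x r \<Longrightarrow> y \<in> c \<longleftrightarrow> u \<bullet> (y - x) \<le> 0"
    using assms by (rule flat_atE) (rule that)
  have "eventually (\<lambda>\<epsilon>. x + \<epsilon> *\<^sub>R u \<in> ball x r \<and> 0 < \<epsilon>) (at_right 0)"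
    by (intro eventually_conj eventually_ray_in_ball eventually_at_right_less) (use r in simp)
  then show ?thesis
    by (rule eventually_mono) (use r in \<open>auto simp: norm_eq_1\<close>)
qed

lemma flat_at_inward:
  assumes "flat_at c x u" "u \<bullet> w < 0"
  shows "eventually (\<lambda>\<epsilon>. x + \<epsilon> *\<^sub>R w \<in> c) (at_right 0)"
proof -
  obtain r where r: "norm u = 1" "0 < r" "\<And>y. y \<in> ball x r \<Longrightarrow> y \<in> c \<longleftrightarrow> u \<bullet> (y - x) \<le> 0"
    using assms(1) by (rule flat_atE) (rule that)
  have "eventually (\<lambda>\<epsilon>. x + \<epsilon> *\<^sub>R w \<in> ball x r \<and> 0 < \<epsilon>) (at_right 0)"
    by (intro eventually_conj eventually_ray_in_ball eventually_at_right_less) (use r in simp)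
  then show ?thesis
    by (rule eventually_mono) (use r assms(2) in \<open>auto simp: mult_le_0_iff\<close>)
qed

lemma flat_at_not_interior:
  assumes "flat_at c x u"
  shows "x \<notin> interior c"
proof
  assume "x \<in> interior c"
  then obtain r where "0 < r" "ball x r \<subseteq> c"
    using mem_interior by blast
  then have "eventually (\<lambda>\<epsilon>. x + \<epsilon> *\<^sub>R u \<in> c) (at_right 0)"
    by (intro eventually_mono[OF eventually_ray_in_ball[of x x r u]]) auto
  then have "eventually (\<lambda>\<epsilon>::real. False) (at_right 0)"
    using flat_at_outward[OF assms] by eventually_elim simp
  then show False by simp
qed

lemma flat_at_nearby:
  assumes "flat_at c x u"
  obtains r where "0 < r" "\<And>y. y \<in> ball x r \<Longrightarrow> u \<bullet> (y - x) = 0 \<Longrightarrow> flat_at c y u"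
proof -
  obtain r where r: "norm u = 1" "0 < r" "\<And>y. y \<in> ball x r \<Longrightarrow> y \<in> c \<longleftrightarrow> u \<bullet> (y - x) \<le> 0"
    using assms by (rule flat_atE) (rule that)
  show thesis
  proof (rule that[OF r(2)])
    fix y assume y: "y \<in> ball x r" "u \<bullet> (y - x) = 0"
    obtain d where d: "0 < d" "ball y d \<subseteq> ball x r"
      using y(1) open_ball open_contains_ball by metis
    show "flat_at c y u"
    proof (rule flat_atI[OF r(1) d(1)])
      fix z assume "z \<in> ball y d"
      then have "z \<in> c \<longleftrightarrow> u \<bullet> (z - x) \<le> 0" using r(3) d(2) by blast
      also have "u \<bullet> (z - x) = u \<bullet> (z - y)" using y(2) by (simp add: inner_diff_right)
      finally show "z \<in> c \<longleftrightarrow> u \<bullet> (z - y) \<le> 0" .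
    qed
  qed
qed

section \<open>Facets, their normals and their affine hulls\<close>

lemma component_mem_of_closure:
  assumes "C \<in> components F" "x \<in> closure C" "x \<in> F"
  shows "x \<in> C"
proof -
  \<comment> \<open>Adding a closure point keeps a connected set connected, so maximality of the
    component absorbs \<open>x\<close>.\<close>
  have "insert x C \<subseteq> closure C"
    using assms(2) closure_subset by blast
  then have "connected (insert x C)"
    using in_components_connected[OF assms(1)] connected_intermediate_closure by blast
  moreover have "insert x C \<subseteq> F" "C \<inter> insert x C \<noteq> {}"
    using assms(3) in_components_subset[OF assms(1)] in_components_nonempty[OF assms(1)] by blast+
  ultimately have "insert x C \<subseteq> C"
    using components_maximal[OF assms(1)] by blast
  then show ?thesis by simp
qed

lemma facet_contains_plane_nbhd:
  assumes C: "C \<in> components {x. \<exists>u. flat_at c x u}" and "x \<in> C" "flat_at c x u"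
  obtains r where "0 < r" "\<And>y. y \<in> ball x r \<Longrightarrow> u \<bullet> (y - x) = 0 \<Longrightarrow> y \<in> C"
proof -
  obtain r where r: "0 < r" "\<And>y. y \<in> ball x r \<Longrightarrow> u \<bullet> (y - x) = 0 \<Longrightarrow> flat_at c y u"
    using flat_at_nearby[OF assms(3)] by blast
  define D where "D = ball x r \<inter> {y. u \<bullet> y = u \<bullet> x}"
  have "x \<in> D" using r by (simp add: D_def)
  moreover have "connected D"
    unfolding D_def by (intro convex_connected convex_Int convex_ball convex_hyperplane)
  moreover have "D \<subseteq> {x. \<exists>u. flat_at c x u}"
  proof
    fix y assume "y \<in> D"
    then have "flat_at c y u" by (intro r(2)) (auto simp: D_def inner_diff_right)
    then show "y \<in> {x. \<exists>u. flat_at c x u}" by blast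
  qed
  ultimately have "D \<subseteq> C"
    using components_maximal[OF C, of D] \<open>x \<in> C\<close> by blast
  then show thesis
    using r(1) by (intro that[of r]) (auto simp: D_def inner_diff_right)
qed

text \<open>\<open>outward_unit_normal\<close> demands flatness with normal \<open>n\<close> at a
  single point only. Around each of its points \<open>C\<close> contains a disc orthogonal to the
  local normal while lying in a hyperplane orthogonal to \<open>n\<close>, so the local normal is
  \<open>n\<close> or \<open>- n\<close>; the sign is locally constant and \<open>C\<close> is
  connected.\<close>

lemma facet_normal_unique:
  assumes C: "C \<in> components {x. \<exists>u. flat_at c x u}"
    and n: "outward_unit_normal c (closure C) n" and "x \<in> C"
  shows "flat_at c x n"
proof -
  have plane: "n \<bullet> (y - z) = 0" if "y \<in> C" "z \<in> C" for y z
    using n that closure_subset[of C] unfolding outward_unit_normal_def by blast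
  obtain x0 where "x0 \<in> closure C" "flat_at c x0 n"
    using n by (auto simp: outward_unit_normal_def)
  then have "x0 \<in> C" using component_mem_of_closure[OF C] by blast
  have "norm n = 1" using n by (simp add: outward_unit_normal_def)
  have normal: "u = n \<or> u = - n" if y: "y \<in> C" "flat_at c y u" for y u
  proof -
    obtain r where r: "0 < r" "\<And>z. z \<in> ball y r \<Longrightarrow> u \<bullet> (z - y) = 0 \<Longrightarrow> z \<in> C"
      using facet_contains_plane_nbhd[OF C y] by blast
    have "u \<bullet> u = 1" using y(2) by (auto simp: flat_at_def norm_eq_1)
    \<comment> \<open>The part of \<open>n\<close> orthogonal to \<open>u\<close>. A short move
      along it stays in \<open>C\<close>, which is orthogonal to \<open>n\<close>, and this forces
      \<open>d = 0\<close>.\<close>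
    define d where "d = n - (n \<bullet> u) *\<^sub>R u"
    have "u \<bullet> d = 0" using \<open>u \<bullet> u = 1\<close> by (simp add: d_def inner_diff_right inner_commute)
    have "n \<bullet> d = 0"
    proof -
      have "eventually (\<lambda>\<epsilon>. y + \<epsilon> *\<^sub>R d \<in> ball y r \<and> 0 < \<epsilon>) (at_right 0)"
        by (intro eventually_conj eventually_ray_in_ball eventually_at_right_less) (use r in simp)
      then obtain \<epsilon> :: real where "y + \<epsilon> *\<^sub>R d \<in> ball y r" "0 < \<epsilon>"
        using eventually_happens'[OF trivial_limit_at_right_real] by blast
      then show ?thesis
        using plane[OF r(2) y(1), of "y + \<epsilon> *\<^sub>R d"] \<open>u \<bullet> d = 0\<close> by simp
    qed
    then have "d \<bullet> d = 0" using \<open>u \<bullet> d = 0\<close> by (simp add: d_def inner_diff_left)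
    then have n_eq: "n = (n \<bullet> u) *\<^sub>R u" by (simp add: d_def)
    then have "\<bar>n \<bullet> u\<bar> = 1"
      using \<open>norm n = 1\<close> \<open>u \<bullet> u = 1\<close> by (metis mult.right_neutral norm_eq_1 norm_scaleR)
    then show ?thesis using n_eq by (cases "n \<bullet> u = 1") (auto simp: abs_if split: if_splits)
  qed
  show ?thesis
  proof (rule connected_induction_simple[of C x0 x "\<lambda>x. flat_at c x n"])
    show "connected C" by (rule in_components_connected[OF C])
    show "flat_at c x0 n" by fact
    fix a assume "a \<in> C"
    then obtain u where u: "flat_at c a u" using in_components_subset[OF C] by blast
    then have "u = n \<or> u = - n" using normal \<open>a \<in> C\<close> by blast
    obtain r where r: "0 < r" "\<And>y. y \<in> ball a r \<Longrightarrow> u \<bullet> (y - a) = 0 \<Longrightarrow> flat_at c y u"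
      using flat_at_nearby[OF u] by blast
    have "flat_at c y u" if "y \<in> C \<inter> ball a r" for y
      using that r(2)[of y] plane[of y a] \<open>a \<in> C\<close> \<open>u = n \<or> u = - n\<close> by auto
    \<comment> \<open>With normal \<open>n\<close> the direction \<open>- n\<close> leads into
      \<open>c\<close>, with normal \<open>- n\<close> it leads out.\<close>
    moreover have "\<not> (flat_at c y n \<and> flat_at c y (- n))" for y
    proof
      assume y: "flat_at c y n \<and> flat_at c y (- n)"
      have "n \<bullet> (- n) < 0" using \<open>norm n = 1\<close> by (simp add: norm_eq_1)
      then have "eventually (\<lambda>\<epsilon>. y + \<epsilon> *\<^sub>R (- n) \<in> c) (at_right 0)"
        using flat_at_inward y by blast
      moreover have "eventually (\<lambda>\<epsilon>. y + \<epsilon> *\<^sub>R (- n) \<notin> c) (at_right 0)"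
        using flat_at_outward y by blast
      ultimately have "eventually (\<lambda>\<epsilon>::real. False) (at_right 0)"
        by eventually_elim simp
      then show False by simp
    qed
    ultimately have "\<forall>x\<in>C \<inter> ball a r. \<forall>y\<in>C \<inter> ball a r. flat_at c x n \<longrightarrow> flat_at c y n"
      using \<open>u = n \<or> u = - n\<close> by blast
    then show "\<exists>T. openin (top_of_set C) T \<and> a \<in> T \<and> (\<forall>x\<in>T. \<forall>y\<in>T. flat_at c x n \<longrightarrow> flat_at c y n)"
      using \<open>a \<in> C\<close> r(1) by (intro exI[of _ "C \<inter> ball a r"]) (auto simp: openin_open)
  qed fact+
qed

text \<open>A disc of the hyperplane inside \<open>C\<close> already spans it. This makes the mirror
  of the reflection an explicit hyperplane.\<close>

lemma affine_hull_facet: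
  assumes C: "C \<in> components {x. \<exists>u. flat_at c x u}"
    and n: "outward_unit_normal c (closure C) n" and "z \<in> C"
  shows "affine hull (closure C) = {x. n \<bullet> x = n \<bullet> z}"
proof
  have "z \<in> closure C" using \<open>z \<in> C\<close> closure_subset by blast
  then have "n \<bullet> (x - z) = 0" if "x \<in> closure C" for x
    using n that unfolding outward_unit_normal_def by blast
  then have "closure C \<subseteq> {x. n \<bullet> x = n \<bullet> z}"
    by (auto simp: inner_diff_right)
  then show "affine hull (closure C) \<subseteq> {x. n \<bullet> x = n \<bullet> z}"
    by (intro hull_minimal affine_hyperplane)
  obtain r where r: "0 < r" "\<And>y. y \<in> ball z r \<Longrightarrow> n \<bullet> (y - z) = 0 \<Longrightarrow> y \<in> C"
    using facet_contains_plane_nbhd[OF C \<open>z \<in> C\<close> facet_normal_unique[OF assms]] by blast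
  have "z \<in> {x. n \<bullet> x = n \<bullet> z} \<inter> ball z r" using r by simp
  then have "affine hull ({x. n \<bullet> x = n \<bullet> z} \<inter> ball z r) = affine hull {x. n \<bullet> x = n \<bullet> z}"
    by (intro affine_hull_convex_Int_open convex_hyperplane) auto
  also have "\<dots> = {x. n \<bullet> x = n \<bullet> z}"
    by (intro hull_same affine_hyperplane)
  finally have "{x. n \<bullet> x = n \<bullet> z} = affine hull ({x. n \<bullet> x = n \<bullet> z} \<inter> ball z r)" ..
  also have "\<dots> \<subseteq> affine hull (closure C)"
  proof (rule hull_mono, rule subset_trans[OF _ closure_subset])
    show "{x. n \<bullet> x = n \<bullet> z} \<inter> ball z r \<subseteq> C"
      using r(2) by (auto simp: inner_diff_right)
  qed
  finally show "{x. n \<bullet> x = n \<bullet> z} \<subseteq> affine hull (closure C)" .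
qed

section \<open>Consequences of the reflected cell being a shift of the cell\<close>

lemma reflection_across_hyperplane:
  assumes "norm n = 1"
  shows "reflection_across {x. n \<bullet> x = h} x = x - (2 * (n \<bullet> x - h)) *\<^sub>R n"
proof -
  have nn: "n \<bullet> n = 1" using assms by (simp add: norm_eq_1)
  define y where "y = x - (n \<bullet> x - h) *\<^sub>R n"
  have "y = closest_point {x. n \<bullet> x = h} x"
  proof (rule closest_point_unique)
    show "y \<in> {x. n \<bullet> x = h}" using nn by (simp add: y_def inner_diff_right)
    \<comment> \<open>The foot \<open>y\<close> of the perpendicular is nearest by Cauchy-Schwarz,
      as \<open>n\<close> is a unit vector.\<close>
    have "dist x y \<le> dist x z" if "n \<bullet> z = h" for z
      using Cauchy_Schwarz_ineq2[of n "x - z"] that assms by (simp add: y_def dist_norm inner_diff_right)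
    then show "\<forall>z\<in>{x. n \<bullet> x = h}. dist x y \<le> dist x z" by blast
  qed (auto intro: convex_hyperplane closed_hyperplane)
  then have "reflection_across {x. n \<bullet> x = h} x = 2 *\<^sub>R y - x"
    by (simp only: reflection_across_def)
  also have "\<dots> = x - (2 * (n \<bullet> x - h)) *\<^sub>R n"
    by (simp add: y_def scaleR_2 scaleR_diff_right)
  finally show ?thesis .
qed

lemma bounded_translation_trivial:
  fixes d :: "'a::real_normed_vector"
  assumes "bounded c" "x \<in> c" and step: "\<And>x. x \<in> c \<Longrightarrow> x - d \<in> c"
  shows "d = 0"
proof (rule ccontr)
  assume "d \<noteq> 0"
  obtain B where B: "\<And>y. y \<in> c \<Longrightarrow> norm y \<le> B" using assms(1) by (auto simp: bounded_iff)
  have iter: "x - real k *\<^sub>R d \<in> c" for k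
    by (induction k) (use assms(2) step in \<open>auto simp: algebra_simps dest: step\<close>)
  obtain k where "(B + norm x) / norm d < real k" using reals_Archimedean2 by blast
  then have "B + norm x < norm (real k *\<^sub>R d)" using \<open>d \<noteq> 0\<close> by (simp add: field_simps)
  also have "\<dots> \<le> norm (x - real k *\<^sub>R d) + norm x"
    using norm_triangle_ineq4[of x "x - real k *\<^sub>R d"] by (simp add: algebra_simps)
  also have "\<dots> \<le> B + norm x" using B[OF iter] by simp
  finally show False by simp
qed

text \<open>The reflected cell differs from \<open>c\<close>, so their interiors are disjoint. This
  keeps the connected interior of \<open>c\<close> off the mirror and on one side of it, and
  boundedness makes the shift between the two cells parallel to \<open>n\<close>.\<close>

lemma capped_cell_of_reflection:
  fixes c :: "'a::euclidean_space set"
  assumes tess: "tessellation_by_shifts T c" and flat: "flat_at c z n" and z: "n \<bullet> z = h"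
    and refl: "reflection_across {x. n \<bullet> x = h} ` c \<in> T"
    and sub: "\<And>\<delta>. 0 < \<delta> \<Longrightarrow> \<exists>t U. 0 < t \<and> t < \<delta> \<and> subdivision c t U"
  obtains \<tau> where "capped_cell c n h \<tau>"
proof -
  have cell: "polyhedral_cell c" and "c \<in> T"
    and disj: "pairwise (\<lambda>d e. interior d \<inter> interior e = {}) T"
    using tess by (auto simp: tessellation_by_shifts_def)
  have cl: "c = closure (interior c)" and conn: "connected (interior c)"
    using cell by (auto simp: polyhedral_cell_def)
  have "bounded c"
    using cell by (auto simp: polyhedral_cell_def polytope_imp_bounded)
  define R where "R x = x - (2 * (n \<bullet> x - h)) *\<^sub>R n" for x
  have "norm n = 1" using flat by (simp add: flat_at_def)
  then have nn: "n \<bullet> n = 1" by (simp add: norm_eq_1)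
  have R_im: "R ` c \<in> T"
    using refl reflection_across_hyperplane[OF \<open>norm n = 1\<close>] by (simp add: R_def[abs_def])
  have nR: "n \<bullet> R x = 2 * h - n \<bullet> x" for x
    using nn by (simp add: R_def inner_diff_right)
  have RR: "R (R x) = x" for x
    unfolding R_def[of "R x"] nR by (simp add: R_def algebra_simps)
  have "z \<in> c" using flat by (rule flat_at_mem)
  have "n \<bullet> (- n) < 0" using nn by simp
  \<comment> \<open>At the flat point \<open>z\<close> the cell lies on one side only of the
    mirror.\<close>
  have "R ` c \<noteq> c"
  proof
    assume eq: "R ` c = c"
    have "eventually (\<lambda>\<epsilon>. z + \<epsilon> *\<^sub>R (- n) \<in> c \<and> z + \<epsilon> *\<^sub>R n \<notin> c) (at_right 0)"
      by (intro eventually_conj flat_at_inward[OF flat] flat_at_outward[OF flat]) fact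
    then obtain \<epsilon> :: real where \<epsilon>: "z + \<epsilon> *\<^sub>R (- n) \<in> c \<and> z + \<epsilon> *\<^sub>R n \<notin> c"
      using eventually_happens'[OF trivial_limit_at_right_real] by blast
    have "R (z + \<epsilon> *\<^sub>R (- n)) = z + \<epsilon> *\<^sub>R n"
      using z nn by (simp add: R_def inner_diff_right algebra_simps flip: scaleR_add_left)
    then show False using \<epsilon> eq by (metis imageI)
  qed
  then have disjR: "interior c \<inter> interior (R ` c) = {}"
    using pairwiseD[OF disj \<open>c \<in> T\<close> R_im] by simp
  \<comment> \<open>An interior point on the mirror is fixed by \<open>R\<close>, hence interior to
    both cells.\<close>
  have off: "n \<bullet> x \<noteq> h" if "x \<in> interior c" for x
  proof
    assume "n \<bullet> x = h"
    then have "R x = x" by (simp add: R_def)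
    have "open (R -` interior c)"
      unfolding R_def by (intro open_vimage open_interior continuous_intros)
    moreover have "R -` interior c \<subseteq> R ` c"
      using RR interior_subset by (metis (no_types, lifting) image_eqI subsetD subsetI vimage_eq)
    ultimately have "x \<in> interior (R ` c)"
      using \<open>R x = x\<close> that by (intro interiorI[of "R -` interior c"]) auto
    then show False using disjR that by blast
  qed
  have conn_sides: "{x. n \<bullet> x < h} \<inter> interior c = {} \<or> {x. n \<bullet> x > h} \<inter> interior c = {}"
    by (rule connectedD[OF conn open_halfspace_lt open_halfspace_gt]) (use off in \<open>auto simp: neq_iff\<close>)
  have "{x. n \<bullet> x < h} \<inter> c \<noteq> {}"
  proof -
    have "eventually (\<lambda>\<epsilon>. z + \<epsilon> *\<^sub>R (- n) \<in> c \<and> 0 < \<epsilon>) (at_right 0)"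
      by (intro eventually_conj flat_at_inward[OF flat] eventually_at_right_less) fact
    then obtain \<epsilon> :: real where "z + \<epsilon> *\<^sub>R (- n) \<in> c" "0 < \<epsilon>"
      using eventually_happens'[OF trivial_limit_at_right_real] by blast
    then have "z + \<epsilon> *\<^sub>R (- n) \<in> {x. n \<bullet> x < h} \<inter> c"
      using z nn by (simp add: inner_diff_right)
    then show ?thesis by blast
  qed
  then have "{x. n \<bullet> x < h} \<inter> interior c \<noteq> {}"
    using open_Int_closure_eq_empty[OF open_halfspace_lt[of n h], of "interior c"] cl by simp
  then have "{x. n \<bullet> x > h} \<inter> interior c = {}" using conn_sides by blast
  then have "{x. n \<bullet> x > h} \<inter> c = {}"
    using open_Int_closure_eq_empty[OF open_halfspace_gt[of h n], of "interior c"] cl by simp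
  then have below: "n \<bullet> x \<le> h" if "x \<in> c" for x
    using that by force
  obtain w where w: "R ` c = (\<lambda>x. x + w) ` c"
    using tess R_im by (auto simp: tessellation_by_shifts_def)
  have shift: "R x - w \<in> c" if "x \<in> c" for x
  proof -
    have "R x \<in> (\<lambda>x. x + w) ` c" using that w by blast
    then show ?thesis by auto
  qed
  \<comment> \<open>Reflecting and shifting back maps \<open>c\<close> into itself. Done twice, it
    is a translation by twice the part of \<open>w\<close> along the mirror, which a bounded set
    admits only if it is zero.\<close>
  have twice: "R (R x - w) - w = x - 2 *\<^sub>R (w - (n \<bullet> w) *\<^sub>R n)" for x
  proof -
    have "R (R x - w) = R (R x) - w + (2 * (n \<bullet> w)) *\<^sub>R n"
      by (simp add: R_def[of "R x - w"] R_def[of "R x"] inner_diff_right algebra_simps)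
    then show ?thesis by (simp add: RR scaleR_2 algebra_simps)
  qed
  have "2 *\<^sub>R (w - (n \<bullet> w) *\<^sub>R n) = 0"
    by (rule bounded_translation_trivial[OF \<open>bounded c\<close> \<open>z \<in> c\<close>]) (metis shift twice)
  then have w_eq: "w = (n \<bullet> w) *\<^sub>R n" by simp
  have drop: "x - (n \<bullet> w) *\<^sub>R n \<in> c" if "x \<in> c" "n \<bullet> x = h" for x
    using shift[OF that(1)] that(2) w_eq by (simp add: R_def)
  have "n \<bullet> w \<noteq> 0"
  proof
    assume "n \<bullet> w = 0"
    then have "w = 0" using w_eq by simp
    then show False using w \<open>R ` c \<noteq> c\<close> by simp
  qed
  \<comment> \<open>The sign of the shift follows because \<open>z\<close> drops to a point of
    \<open>c\<close>, which is not above \<open>h\<close>.\<close>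
  moreover have "0 \<le> n \<bullet> w"
    using below[OF drop[OF \<open>z \<in> c\<close> z]] z nn by (simp add: inner_diff_right)
  ultimately have "capped_cell c n h (n \<bullet> w)"
    using \<open>bounded c\<close> cl conn \<open>norm n = 1\<close> below \<open>z \<in> c\<close> z drop sub
    by unfold_locales auto
  then show thesis by (rule that)
qed

section \<open>The cone at an edge between two facets\<close>

lemma flat_at_local:
  assumes loc: "\<And>y. y \<in> ball p r \<Longrightarrow> y \<in> c \<longleftrightarrow> y - p \<in> K" and z: "z \<in> ball p r"
  shows "flat_at c z u \<longleftrightarrow> flat_at K (z - p) u"
proof -
  obtain d where d: "0 < d" "ball z d \<subseteq> ball p r"
    using z open_ball open_contains_ball by metis
  show ?thesis
  proof
    assume "flat_at c z u"
    then obtain s where s: "norm u = 1" "0 < s" "\<And>y. y \<in> ball z s \<Longrightarrow> y \<in> c \<longleftrightarrow> u \<bullet> (y - z) \<le> 0"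
      by (rule flat_atE) (rule that)
    show "flat_at K (z - p) u"
    proof (rule flat_atI[OF s(1), of "min s d"])
      fix v assume "v \<in> ball (z - p) (min s d)"
      then have *: "v + p \<in> ball z s" "v + p \<in> ball z d"
        by (auto simp: dist_norm algebra_simps)
      then have "v \<in> K \<longleftrightarrow> v + p \<in> c" using loc[of "v + p"] d(2) by auto
      also have "\<dots> \<longleftrightarrow> u \<bullet> (v + p - z) \<le> 0" by (rule s(3)[OF *(1)])
      finally show "v \<in> K \<longleftrightarrow> u \<bullet> (v - (z - p)) \<le> 0" by (simp add: algebra_simps)
    qed (use s d in simp)
  next
    assume "flat_at K (z - p) u"
    then obtain s where s: "norm u = 1" "0 < s" "\<And>y. y \<in> ball (z - p) s \<Longrightarrow> y \<in> K \<longleftrightarrow> u \<bullet> (y - (z - p)) \<le> 0"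
      by (rule flat_atE) (rule that)
    show "flat_at c z u"
    proof (rule flat_atI[OF s(1), of "min s d"])
      fix y assume "y \<in> ball z (min s d)"
      then have *: "y - p \<in> ball (z - p) s" "y \<in> ball z d"
        by (auto simp: dist_norm)
      then have "y \<in> c \<longleftrightarrow> y - p \<in> K" using loc[of y] d(2) by auto
      also have "\<dots> \<longleftrightarrow> u \<bullet> (y - p - (z - p)) \<le> 0" by (rule s(3)[OF *(1)])
      finally show "y \<in> c \<longleftrightarrow> u \<bullet> (y - z) \<le> 0" by simp
    qed (use s d in simp)
  qed
qed

lemma flat_at_translate:
  assumes "flat_at K v u" and inv: "\<And>x. x + l \<in> K \<longleftrightarrow> x \<in> K"
  shows "flat_at K (v + l) u"
proof -
  obtain s where s: "norm u = 1" "0 < s" "\<And>y. y \<in> ball v s \<Longrightarrow> y \<in> K \<longleftrightarrow> u \<bullet> (y - v) \<le> 0"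
    using assms(1) by (rule flat_atE) (rule that)
  show ?thesis
  proof (rule flat_atI[OF s(1,2)])
    fix y assume "y \<in> ball (v + l) s"
    then have "y - l \<in> ball v s" by (simp add: dist_norm algebra_simps)
    then show "y \<in> K \<longleftrightarrow> u \<bullet> (y - (v + l)) \<le> 0"
      using s(3)[of "y - l"] inv[of "y - l"] by (simp add: algebra_simps)
  qed
qed

lemma flat_at_scale:
  assumes "flat_at K v u" and cone: "\<And>t v. 0 < t \<Longrightarrow> v \<in> K \<Longrightarrow> t *\<^sub>R v \<in> K" and "0 < t"
  shows "flat_at K (t *\<^sub>R v) u"
proof -
  obtain s where s: "norm u = 1" "0 < s" "\<And>y. y \<in> ball v s \<Longrightarrow> y \<in> K \<longleftrightarrow> u \<bullet> (y - v) \<le> 0"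
    using assms(1) by (rule flat_atE) (rule that)
  show ?thesis
  proof (rule flat_atI[OF s(1), of "t * s"])
    fix y assume y: "y \<in> ball (t *\<^sub>R v) (t * s)"
    define x where "x = (1 / t) *\<^sub>R y"
    have yx: "y = t *\<^sub>R x" using \<open>0 < t\<close> by (simp add: x_def)
    have "t * norm (v - x) < t * s"
      using y \<open>0 < t\<close> by (simp add: yx dist_norm flip: scaleR_diff_right)
    then have "x \<in> ball v s" using \<open>0 < t\<close> by (simp add: dist_norm)
    then have "x \<in> K \<longleftrightarrow> u \<bullet> (x - v) \<le> 0" by (rule s(3))
    moreover have "x \<in> K \<longleftrightarrow> y \<in> K"
      using cone[of t x] cone[of "1 / t" y] \<open>0 < t\<close> by (auto simp: yx)
    moreover have "u \<bullet> (y - t *\<^sub>R v) = t * (u \<bullet> (x - v))"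
      by (simp add: yx algebra_simps)
    ultimately show "y \<in> K \<longleftrightarrow> u \<bullet> (y - t *\<^sub>R v) \<le> 0"
      using \<open>0 < t\<close> by (simp add: mult_le_0_iff)
  qed (use s \<open>0 < t\<close> in simp)
qed

text \<open>Take \<open>e\<close> orthogonal to \<open>n\<close> and \<open>A\<close>. The vectors
  orthogonal to both \<open>n\<close> and \<open>e\<close> contain \<open>A\<close> and form a space
  of the same dimension, so edge directions are described by two equations.\<close>

lemma codim2_complement:
  fixes n :: "'a::euclidean_space"
  assumes "norm n = 1" and dim: "dim A + 2 = DIM('a)" and orth: "\<And>l. l \<in> A \<Longrightarrow> n \<bullet> l = 0"
  obtains e where "norm e = 1" "n \<bullet> e = 0" "span A = {l. n \<bullet> l = 0 \<and> e \<bullet> l = 0}"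
proof -
  have "dim (insert n A) < DIM('a)"
    using dim by (simp add: dim_insert)
  then obtain x where x: "x \<noteq> 0" "\<And>y. y \<in> span (insert n A) \<Longrightarrow> orthogonal x y"
    using orthogonal_to_subspace_exists by blast
  define e where "e = (1 / norm x) *\<^sub>R x"
  have "norm e = 1" using x by (simp add: e_def)
  have e_orth: "e \<bullet> y = 0" if "y \<in> insert n A" for y
    using x(2)[OF span_base[OF that]] by (simp add: e_def orthogonal_def)
  have "n \<bullet> e = 0" using e_orth[of n] by (simp add: inner_commute)
  define B where "B = {l. n \<bullet> l = 0 \<and> e \<bullet> l = 0}"
  have "n \<noteq> e" using \<open>n \<bullet> e = 0\<close> \<open>norm e = 1\<close> by (auto simp: norm_eq_1)
  have "independent {n, e}"
  proof (rule pairwise_orthogonal_independent)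
    show "pairwise orthogonal {n, e}"
      using \<open>n \<bullet> e = 0\<close> by (auto simp: pairwise_def orthogonal_def inner_commute)
    show "0 \<notin> {n, e}" using assms(1) \<open>norm e = 1\<close> by auto
  qed
  then have "dim {n, e} = 2"
    using \<open>n \<noteq> e\<close> dim_eq_card_independent[of "{n, e}"] by simp
  have "B = {y \<in> UNIV. \<forall>x\<in>span {n, e}. orthogonal x y}"
  proof -
    have "orthogonal x y" if "n \<bullet> y = 0" "e \<bullet> y = 0" "x \<in> span {n, e}" for x y
      using that by (intro orthogonal_to_span[of x "{n, e}" y, unfolded orthogonal_commute[of y]])
        (auto simp: orthogonal_def)
    then show ?thesis
      using span_base[of n "{n, e}"] span_base[of e "{n, e}"] by (auto simp: B_def orthogonal_def)
  qed
  then have "dim B + dim (span {n, e}) = DIM('a)"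
    using dim_subspace_orthogonal_to_vectors[OF subspace_span subspace_UNIV, of "{n, e}"] by simp
  then have "dim B = dim A"
    using dim \<open>dim {n, e} = 2\<close> by simp
  have "subspace B"
    by (auto simp: B_def subspace_def inner_add_right)
  moreover have "A \<subseteq> B"
    using orth e_orth by (auto simp: B_def)
  ultimately have "span A = B"
    using \<open>dim B = dim A\<close> by (intro subspace_dim_equal) (auto simp: span_minimal)
  then show thesis
    using that \<open>norm e = 1\<close> \<open>n \<bullet> e = 0\<close> by (simp add: B_def)
qed

text \<open>By \<open>inv\<close>, membership in \<open>K\<close> depends only on the coordinates
  \<open>n \<bullet> v\<close> and \<open>e \<bullet> v\<close>: \<open>K\<close> is a plane cone
  times the edge directions.\<close>

locale capped_cell_cone = capped_cell c n h \<tau>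
  for c :: "'a::euclidean_space set" and n h \<tau> +
  fixes K :: "'a set" and p e :: 'a and r :: real
  assumes norm_e: "norm e = 1" and n_e: "n \<bullet> e = 0"
    and p: "p \<in> c" "n \<bullet> p = h" and r_pos: "0 < r" and closed_K: "closed K"
    and cone: "0 < t \<Longrightarrow> v \<in> K \<Longrightarrow> t *\<^sub>R v \<in> K"
    and inv: "v \<in> K \<Longrightarrow> n \<bullet> l = 0 \<Longrightarrow> e \<bullet> l = 0 \<Longrightarrow> v + l \<in> K"
    and loc: "y \<in> ball p r \<Longrightarrow> y \<in> c \<longleftrightarrow> y - p \<in> K"
begin

lemma e_n: "e \<bullet> n = 0" "e \<bullet> e = 1"
  using n_e norm_e by (auto simp: inner_commute norm_eq_1)

lemma inv_iff: "n \<bullet> l = 0 \<Longrightarrow> e \<bullet> l = 0 \<Longrightarrow> x + l \<in> K \<longleftrightarrow> x \<in> K"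
  using inv[of x l] inv[of "x + l" "- l"] by auto

lemma cone_below:
  assumes "v \<in> K"
  shows "n \<bullet> v \<le> 0"
proof -
  have "eventually (\<lambda>\<epsilon>. p + \<epsilon> *\<^sub>R v \<in> ball p r \<and> 0 < \<epsilon>) (at_right 0)"
    by (intro eventually_conj eventually_ray_in_ball eventually_at_right_less) (use r_pos in simp)
  then obtain \<epsilon> :: real where \<epsilon>: "p + \<epsilon> *\<^sub>R v \<in> ball p r" "0 < \<epsilon>"
    using eventually_happens'[OF trivial_limit_at_right_real] by blast
  then have "p + \<epsilon> *\<^sub>R v \<in> c" using loc[OF \<epsilon>(1)] cone[OF \<epsilon>(2) assms] by simp
  then have "\<epsilon> * (n \<bullet> v) \<le> 0" using below p(2) by (fastforce simp: inner_add_right)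
  then show ?thesis using \<epsilon>(2) by (simp add: mult_le_0_iff)
qed

text \<open>\<open>cone_shifts_down\<close> starts from a point of negative height, while
  \<open>v\<close> may have height 0. Flatness with \<open>0 < u \<bullet> n\<close> supplies a
  first small step down inside \<open>K\<close>.\<close>

lemma flat_shifts_down:
  assumes "flat_at K v u" "0 < u \<bullet> n" "0 < \<mu>"
  shows "v - \<mu> *\<^sub>R n \<in> K"
proof -
  have "eventually (\<lambda>\<epsilon>. v + \<epsilon> *\<^sub>R (- n) \<in> K \<and> \<epsilon> \<in> {0<..<\<mu>}) (at_right 0)"
    by (intro eventually_conj flat_at_inward[OF assms(1)] eventually_at_right_real) (use assms in auto)
  then obtain \<epsilon> :: real where \<epsilon>: "v - \<epsilon> *\<^sub>R n \<in> K" "0 < \<epsilon>" "\<epsilon> < \<mu>"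
    using eventually_happens'[OF trivial_limit_at_right_real] by fastforce
  have "n \<bullet> v \<le> 0" using cone_below[OF flat_at_mem[OF assms(1)]] .
  then have neg: "n \<bullet> (v - \<epsilon> *\<^sub>R n) < 0" using \<epsilon>(2) by (simp add: inner_diff_right inner_n)
  have "0 \<le> \<mu> - \<epsilon>" using \<epsilon>(3) by simp
  then have "v - \<epsilon> *\<^sub>R n - (\<mu> - \<epsilon>) *\<^sub>R n \<in> K"
    using cone_shifts_down[OF norm_e n_e cone inv p(2) r_pos loc \<epsilon>(1) neg] by blast
  then show ?thesis by (simp add: algebra_simps)
qed

lemma below_flat_ray:
  assumes "flat_at K x u" "0 < u \<bullet> n" and t: "0 < (e \<bullet> v) / (e \<bullet> x)" "n \<bullet> v < (e \<bullet> v) / (e \<bullet> x) * (n \<bullet> x)"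
  shows "v \<in> K"
proof -
  define t where "t = (e \<bullet> v) / (e \<bullet> x)"
  \<comment> \<open>Chosen so that \<open>t *\<^sub>R (x - \<mu> *\<^sub>R n)\<close> has the same
    two coordinates as \<open>v\<close>; the difference \<open>l\<close> is an edge
    direction.\<close>
  define \<mu> where "\<mu> = (t * (n \<bullet> x) - n \<bullet> v) / t"
  have "0 < t" and et: "t * (e \<bullet> x) = e \<bullet> v"
    using t(1) by (auto simp: t_def zero_less_divide_iff)
  have "0 < \<mu>" and nt: "t * \<mu> = t * (n \<bullet> x) - n \<bullet> v"
    using t(2) \<open>0 < t\<close> unfolding t_def[symmetric] \<mu>_def by auto
  define l where "l = v - t *\<^sub>R (x - \<mu> *\<^sub>R n)"
  have "t *\<^sub>R (x - \<mu> *\<^sub>R n) \<in> K"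
    using flat_shifts_down[OF assms(1,2) \<open>0 < \<mu>\<close>] cone \<open>0 < t\<close> by blast
  moreover have "n \<bullet> l = 0" "e \<bullet> l = 0"
    by (simp_all add: l_def inner_diff_right inner_n e_n et nt right_diff_distrib)
  ultimately have "t *\<^sub>R (x - \<mu> *\<^sub>R n) + l \<in> K" by (rule inv)
  then show ?thesis by (simp add: l_def)
qed

text \<open>\<open>K\<close> contains everything below the two flat rays, on both sides of the axis
  \<open>e \<bullet> v = 0\<close>, so \<open>- n\<close> is interior to \<open>K\<close>. Then
  \<open>cone_is_halfspace\<close>, applied at the flat point \<open>p + v2\<close>, makes
  \<open>K\<close> a half-space.\<close>

lemma flat_at_apex_of_opposite:
  assumes flat1: "flat_at K v1 u" "0 < u \<bullet> n" and flat2: "flat_at K v2 n"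
    and v2: "n \<bullet> v2 = 0" and opp: "(e \<bullet> v1) * (e \<bullet> v2) < 0" and "p + v2 \<in> ball p r"
  shows "flat_at K 0 n"
proof -
  define a where "a = e \<bullet> v1"
  define b where "b = e \<bullet> v2"
  have ab: "a \<noteq> 0" "b \<noteq> 0" using opp by (auto simp: a_def b_def)
  \<comment> \<open>In the two coordinates, the points below height 0 and below the line through the
    apex and \<open>v1\<close>; this is an open neighbourhood of \<open>- n\<close>.\<close>
  define N where "N = {v. n \<bullet> v < 0} \<inter> {v. n \<bullet> v < (e \<bullet> v) / a * (n \<bullet> v1)}"
  have n2: "0 < n \<bullet> n" by (simp add: inner_n)
  have same2: "v \<in> K" if "n \<bullet> v < 0" "0 < (e \<bullet> v) / b" for v
    using below_flat_ray[OF flat2 n2, of v] that v2 by (simp add: b_def)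
  have "N \<subseteq> K"
  proof
    fix v assume v: "v \<in> N"
    show "v \<in> K"
    proof (cases "e \<bullet> v = 0")
      case True
      \<comment> \<open>Points on the axis are limits of points of \<open>K\<close> on the side of
        \<open>v2\<close>, and \<open>K\<close> is closed.\<close>
      have "v + \<epsilon> *\<^sub>R (b *\<^sub>R e) \<in> K" if "0 < \<epsilon>" for \<epsilon>
        using same2[of "v + \<epsilon> *\<^sub>R (b *\<^sub>R e)"] v True that ab by (simp add: N_def inner_add_right n_e e_n)
      then have "eventually (\<lambda>\<epsilon>. v + \<epsilon> *\<^sub>R (b *\<^sub>R e) \<in> K) (at_right 0)"
        using eventually_at_right_less[of "0::real"] by (rule eventually_mono[rotated])
      moreover have "((\<lambda>\<epsilon>. v + \<epsilon> *\<^sub>R (b *\<^sub>R e)) \<longlongrightarrow> v) (at_right 0)"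
        by (auto intro!: tendsto_eq_intros)
      ultimately show ?thesis
        by (rule Lim_in_closed_set[OF closed_K _ trivial_limit_at_right_real])
    next
      case False
      then consider "0 < (e \<bullet> v) / b" | "0 < (e \<bullet> v) / a"
        using opp ab by (cases "e \<bullet> v < 0") (auto simp: a_def b_def zero_less_divide_iff mult_less_0_iff)
      then show ?thesis
        using same2[of v] below_flat_ray[OF flat1, of v] v by cases (auto simp: N_def a_def)
    qed
  qed
  moreover have "open N"
    unfolding N_def using ab by (intro open_Int open_Collect_less continuous_intros) auto
  moreover have "- n \<in> N"
    by (simp add: N_def inner_n e_n)
  ultimately have down: "- n \<in> interior K" by (intro interiorI)
  define z where "z = p + v2"
  have flat_z: "flat_at c z n"
    using flat_at_local[OF loc \<open>p + v2 \<in> ball p r\<close>, of n] flat2 by (simp add: z_def)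
  then obtain \<rho> where \<rho>: "0 < \<rho>" "\<And>y. y \<in> ball z \<rho> \<Longrightarrow> y \<in> c \<longleftrightarrow> n \<bullet> (y - z) \<le> 0"
    by (rule flat_atE) (rule that)
  have "n \<bullet> z = h" using p(2) v2 by (simp add: z_def inner_add_right)
  then have \<rho>': "y \<in> c \<longleftrightarrow> n \<bullet> y \<le> h" if "y \<in> ball z \<rho>" for y
    using \<rho>(2)[OF that] by (simp add: inner_diff_right)
  have "v \<in> K" if "n \<bullet> v \<le> 0" for v
    using cone_is_halfspace[OF flat_at_mem[OF flat_z] \<open>n \<bullet> z = h\<close> \<rho>(1) \<rho>' cone p r_pos loc down that] .
  then show ?thesis
    using cone_below by (intro flat_atI[OF norm_n zero_less_one]) auto
qed

text \<open>The two points lie on one ray up to an edge direction, and flatness survives both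
  scaling and such a translation.\<close>

lemma flat_at_along:
  assumes "flat_at K v u" and "n \<bullet> v = 0" "n \<bullet> w = 0" "0 < (e \<bullet> w) / (e \<bullet> v)"
  shows "flat_at K w u"
proof -
  define t where "t = (e \<bullet> w) / (e \<bullet> v)"
  have "0 < t" "t * (e \<bullet> v) = e \<bullet> w"
    using assms(4) by (auto simp: t_def zero_less_divide_iff)
  then have "flat_at K (t *\<^sub>R v + (w - t *\<^sub>R v)) u"
    using assms(2,3) by (intro flat_at_translate flat_at_scale[OF assms(1)] cone inv_iff)
      (simp_all add: inner_diff_right)
  then show ?thesis by simp
qed

lemma flat_at_apex:
  assumes "flat_at K v u" "n \<bullet> v = 0" "e \<bullet> v = 0"
  shows "flat_at K 0 u"
  using flat_at_translate[OF assms(1), of "- v"] inv_iff[of "- v"] assms(2,3) by simp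

text \<open>The open quadrant below the flat ray is contained in \<open>K\<close>, so its points are
  interior and not flat.\<close>

lemma no_flat_point_under_flat_ray:
  assumes "flat_at K v n" "n \<bullet> v = 0" and "n \<bullet> w < 0" "0 < (e \<bullet> w) / (e \<bullet> v)"
  shows "\<not> flat_at K w u"
proof -
  have "e \<bullet> v \<noteq> 0" using assms(4) by auto
  define N where "N = {w. n \<bullet> w < 0} \<inter> {w. 0 < (e \<bullet> w) / (e \<bullet> v)}"
  have "open N"
    unfolding N_def using \<open>e \<bullet> v \<noteq> 0\<close> by (intro open_Int open_Collect_less continuous_intros) auto
  moreover have "N \<subseteq> K"
    using below_flat_ray[OF assms(1)] assms(2) by (auto simp: N_def inner_n)
  moreover have "w \<in> N" using assms(3,4) by (simp add: N_def)
  ultimately have "w \<in> interior K" by (intro interiorI)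
  then show ?thesis using flat_at_not_interior by blast
qed

end

section \<open>Contradiction at the common edge of the two facets\<close>

theorem proposition3:
  fixes T :: "'a::euclidean_space set set" and c f1 f2 :: "'a set"
  assumes "tessellation_by_shifts T c"
    and "cell_facet c f1" and "cell_facet c f2" and "f1 \<noteq> f2"
    and "meet_with_obtuse_angle c f1 f2"
    and "reflection_across (affine hull f2) ` c \<in> T"
  shows "\<not> refinable T"
proof
  assume "refinable T"
  define F where "F = {x. \<exists>u. flat_at c x u}"
  obtain C1 C2 where C: "C1 \<in> components F" "C2 \<in> components F" and f: "f1 = closure C1" "f2 = closure C2"
    using assms(2,3) by (auto simp: cell_facet_def F_def)
  note C' = C[unfolded F_def]
  have "C1 \<noteq> C2" using \<open>f1 \<noteq> f2\<close> f by blast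
  obtain S n1 n2 where S: "S \<noteq> {}" "S \<subseteq> f1 \<inter> f2" "convex S" "aff_dim S = int DIM('a) - 2"
    and normal: "outward_unit_normal c f1 n1" "outward_unit_normal c f2 n2" and obtuse: "n1 \<bullet> n2 > 0"
    using assms(5) by (auto simp: meet_with_obtuse_angle_def abutting_def)
  have unit: "norm n1 = 1" "norm n2 = 1" using normal by (auto simp: outward_unit_normal_def)
  have plane1: "n1 \<bullet> (x - y) = 0" if "x \<in> f1" "y \<in> f1" for x y
    using normal(1) that by (auto simp: outward_unit_normal_def)
  have plane2: "n2 \<bullet> (x - y) = 0" if "x \<in> f2" "y \<in> f2" for x y
    using normal(2) that by (auto simp: outward_unit_normal_def)
  have cell: "polyhedral_cell c" using assms(1) by (simp add: tessellation_by_shifts_def)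
  then obtain \<P> where P: "finite \<P>" "\<And>P. P \<in> \<P> \<Longrightarrow> polytope P" "c = \<Union>\<P>"
    by (auto simp: polyhedral_cell_def)
  have "closed c" using cell by (metis closed_closure polyhedral_cell_def)
  obtain p K r where p: "p \<in> S" and r: "0 < r" and K: "closed K"
      "\<And>t v. 0 < t \<Longrightarrow> v \<in> K \<Longrightarrow> t *\<^sub>R v \<in> K"
      "\<And>v l. v \<in> K \<Longrightarrow> l \<in> span ((\<lambda>x. x - p) ` S) \<Longrightarrow> v + l \<in> K"
      "\<And>y. y \<in> ball p r \<Longrightarrow> y \<in> c \<longleftrightarrow> y - p \<in> K"
    using polytopes_conic_at_generic_point[OF P(1,2) S(3,1)] unfolding P(3) by metis
  \<comment> \<open>The directions of the common piece, of dimension \<open>DIM('a) - 2\<close> and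
    orthogonal to both normals.\<close>
  define A where "A = (\<lambda>x. x - p) ` S"
  have "p \<in> f1" "p \<in> f2" using p S(2) by auto
  have "dim A + 2 = DIM('a)"
    using aff_dim_eq_dim_subtract[OF hull_inc[OF p]] S(4) by (simp add: A_def)
  moreover have A_orth: "n1 \<bullet> l = 0" "n2 \<bullet> l = 0" if l: "l \<in> A" for l
  proof -
    obtain x where "x \<in> S" "l = x - p" using l by (auto simp: A_def)
    moreover have "x \<in> f1" "x \<in> f2" using \<open>x \<in> S\<close> S(2) by auto
    ultimately show "n1 \<bullet> l = 0" "n2 \<bullet> l = 0"
      using plane1 plane2 \<open>p \<in> f1\<close> \<open>p \<in> f2\<close> by simp_all
  qed
  ultimately obtain e where e: "norm e = 1" "n2 \<bullet> e = 0" "span A = {l. n2 \<bullet> l = 0 \<and> e \<bullet> l = 0}"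
    using codim2_complement[OF unit(2)] by metis
  define h where "h = n2 \<bullet> p"
  obtain z where z: "z \<in> f2" "flat_at c z n2" using normal(2) by (auto simp: outward_unit_normal_def)
  then have "z \<in> C2"
    using component_mem_of_closure[OF C(2)] by (auto simp: f F_def)
  have "n2 \<bullet> z = h" using plane2[OF z(1) \<open>p \<in> f2\<close>] by (simp add: h_def inner_diff_right)
  have hull: "affine hull f2 = {x. n2 \<bullet> x = h}"
    using affine_hull_facet[OF C'(2) normal(2)[unfolded f] \<open>z \<in> C2\<close>] \<open>n2 \<bullet> z = h\<close> f(2) by simp
  obtain s U where s: "0 < s" "s < 1" "subdivision c s U"
    using refinable_subdivision[OF assms(1) \<open>refinable T\<close>] by blast
  have small: "\<exists>t U. 0 < t \<and> t < \<delta> \<and> subdivision c t U" if "0 < \<delta>" for \<delta>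
    using subdivision_small[OF s(3,1,2) that] by metis
  obtain \<tau> where "capped_cell c n2 h \<tau>"
    using capped_cell_of_reflection[OF assms(1) z(2) \<open>n2 \<bullet> z = h\<close> assms(6)[unfolded hull] small] by blast
  then interpret capped_cell c n2 h \<tau> .
  have sub_c: "C1 \<subseteq> c" "C2 \<subseteq> c"
  proof -
    have "F \<subseteq> c" by (auto simp: F_def intro: flat_at_mem)
    then show "C1 \<subseteq> c" "C2 \<subseteq> c"
      using in_components_subset C by blast+
  qed
  have "p \<in> c"
    using \<open>p \<in> f2\<close> closure_minimal[OF sub_c(2) \<open>closed c\<close>] f by blast
  interpret capped_cell_cone c n2 h \<tau> K p e r
    using e \<open>p \<in> c\<close> r K by unfold_locales (auto simp: h_def A_def)
  \<comment> \<open>A flat apex would make \<open>p\<close> a flat point in the closure of both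
    components, and hence a point of both.\<close>
  have not_flat: "\<not> flat_at K 0 u" for u
  proof
    assume "flat_at K 0 u"
    then have "p \<in> F" using flat_at_local[where z=p and u=u, OF K(4)] r by (auto simp: F_def)
    then have "p \<in> C1" "p \<in> C2"
      using component_mem_of_closure C \<open>p \<in> f1\<close> \<open>p \<in> f2\<close> f by blast+
    then show False using C \<open>C1 \<noteq> C2\<close> components_nonoverlap by blast
  qed
  \<comment> \<open>Flat points of the two facets close enough to \<open>p\<close> to be seen in the
    cone \<open>K\<close>.\<close>
  obtain z1 z2 where zs: "z1 \<in> C1" "z1 \<in> ball p r" "z2 \<in> C2" "z2 \<in> ball p r"
    using \<open>p \<in> f1\<close> \<open>p \<in> f2\<close> r unfolding f closure_approachable by (metis dist_commute mem_ball)
  define v1 v2 where "v1 = z1 - p" and "v2 = z2 - p"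
  have flat1: "flat_at K v1 n1"
    using facet_normal_unique[OF C'(1) normal(1)[unfolded f] zs(1)] flat_at_local[OF K(4) zs(2)]
    by (simp add: v1_def)
  have flat2: "flat_at K v2 n2"
    using facet_normal_unique[OF C'(2) normal(2)[unfolded f] zs(3)] flat_at_local[OF K(4) zs(4)]
    by (simp add: v2_def)
  have v1: "n1 \<bullet> v1 = 0" and v2: "n2 \<bullet> v2 = 0"
    using plane1[of z1 p] plane2[of z2 p] zs closure_subset[of C1] closure_subset[of C2] \<open>p \<in> f1\<close> \<open>p \<in> f2\<close>
    by (auto simp: v1_def v2_def f)
  have "e \<bullet> v2 \<noteq> 0" using flat_at_apex[OF flat2 v2] not_flat by blast
  define \<kappa> \<eta> where "\<kappa> = n1 \<bullet> n2" and "\<eta> = n1 \<bullet> e"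
  \<comment> \<open>\<open>n1\<close> is orthogonal to the edge directions, so it lies in the plane
    of \<open>n2\<close> and \<open>e\<close>.\<close>
  have n1_eq: "n1 = \<kappa> *\<^sub>R n2 + \<eta> *\<^sub>R e"
  proof -
    define l where "l = n1 - (\<kappa> *\<^sub>R n2 + \<eta> *\<^sub>R e)"
    have l: "n2 \<bullet> l = 0" "e \<bullet> l = 0"
      by (simp_all add: l_def inner_diff_right inner_add_right inner_n e_n n_e \<kappa>_def \<eta>_def inner_commute)
    then have "l \<in> span A" using e(3) by simp
    then have "n1 \<bullet> l = 0"
      by (induction rule: span_induct) (use A_orth in \<open>auto simp: subspace_hyperplane\<close>)
    then have "l \<bullet> l = 0"
      using l by (subst l_def) (simp add: inner_diff_left inner_add_left)
    then show ?thesis by (simp add: l_def)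
  qed
  have rel: "\<kappa> * (n2 \<bullet> v1) + \<eta> * (e \<bullet> v1) = 0"
    using v1 by (simp add: n1_eq inner_add_left)
  have "0 < \<kappa>" using obtuse by (simp add: \<kappa>_def)
  \<comment> \<open>Here the obtuse angle enters: with \<open>0 < \<kappa>\<close>,
    \<open>e \<bullet> v1 = 0\<close> would give \<open>v1\<close> height 0, making it an edge
    direction and the apex flat.\<close>
  have "e \<bullet> v1 \<noteq> 0"
    using rel \<open>0 < \<kappa>\<close> flat_at_apex[OF flat1] not_flat by auto
  have "n2 \<bullet> v1 \<le> 0" using cone_below flat_at_mem[OF flat1] by blast
  \<comment> \<open>The facets leave the edge to opposite sides or to the same side of the
    axis.\<close>
  consider "(e \<bullet> v1) * (e \<bullet> v2) < 0" | "0 < (e \<bullet> v1) / (e \<bullet> v2)"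
    using \<open>e \<bullet> v1 \<noteq> 0\<close> \<open>e \<bullet> v2 \<noteq> 0\<close>
    by (cases "e \<bullet> v1 < 0"; cases "e \<bullet> v2 < 0"; force simp: mult_less_0_iff zero_less_divide_iff)
  then show False
  proof cases
    case 1
    have "p + v2 \<in> ball p r" using zs(4) by (simp add: v2_def)
    then show False
      using flat_at_apex_of_opposite[OF flat1 obtuse flat2 v2 1] not_flat by blast
  next
    case 2
    \<comment> \<open>On the same side, \<open>v1\<close> cannot be strictly below the flat ray of
      \<open>v2\<close>, so it lies on the same half-hyperplane. The segment from \<open>z1\<close>
      to \<open>z2\<close> then consists of flat points and joins the two components.\<close>
    have "n2 \<bullet> v1 = 0"
      using no_flat_point_under_flat_ray[OF flat2 v2 _ 2] flat1 \<open>n2 \<bullet> v1 \<le> 0\<close> by fastforce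
    have seg: "flat_at K ((1 - t) *\<^sub>R v1 + t *\<^sub>R v2) n2" if "0 \<le> t" "t \<le> 1" for t
    proof (rule flat_at_along[OF flat2 v2])
      have "0 < (1 - t) * ((e \<bullet> v1) / (e \<bullet> v2)) + t"
        using 2 that mult_nonneg_nonneg[of "1 - t" "(e \<bullet> v1) / (e \<bullet> v2)"]
        by (cases "t = 0") (simp, linarith)
      then show "0 < (e \<bullet> ((1 - t) *\<^sub>R v1 + t *\<^sub>R v2)) / (e \<bullet> v2)"
        using \<open>e \<bullet> v2 \<noteq> 0\<close> by (simp add: inner_add_right add_divide_distrib)
    qed (simp add: inner_add_right \<open>n2 \<bullet> v1 = 0\<close> v2)
    have "closed_segment z1 z2 \<subseteq> F"
    proof
      fix y assume y: "y \<in> closed_segment z1 z2"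
      then obtain t where t: "0 \<le> t" "t \<le> 1" "y = (1 - t) *\<^sub>R z1 + t *\<^sub>R z2"
        by (auto simp: in_segment)
      have "y \<in> ball p r"
        using y zs closed_segment_subset[OF _ _ convex_ball] by blast
      moreover have "y - p = (1 - t) *\<^sub>R v1 + t *\<^sub>R v2"
        by (simp add: t(3) v1_def v2_def algebra_simps)
      ultimately show "y \<in> F"
        using flat_at_local[where z=y and u=n2, OF K(4)] seg[OF t(1,2)] by (auto simp: F_def)
    qed
    then have "closed_segment z1 z2 \<subseteq> C1"
      using components_maximal[OF C(1) connected_segment(1)] zs(1) by blast
    then have "z2 \<in> C1" by auto
    then show False
      using zs(3) C \<open>C1 \<noteq> C2\<close> components_nonoverlap by blast
  qed
qed

end
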